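(* Fix the dimension $d$ and constants $a_1\ge a_2\ge\cdots\ge a_d>0$, and let $c>\frac{d-1}{2\sum_{i=2}^d a_i+a_1}$. If $p=\frac{c\log n}{n}$, then, asymptotically almost surely as $n\to\infty$, every vertex in the random site subgraph of the Hamming torus is either isolated or belongs to the giant component.
   Context: The $d$-dimensional Hamming torus (with parameters $a_1,\ldots,a_d>0$ and $n$) is the graph with vertex set $V=\{(x_1,\ldots,x_d)\in\mathbb{Z}^d: 1\le x_i\le a_i n,\ i=1,\ldots,d\}$ in which two vertices are adjacent exactly when they differ in exactly one coordinate (Hamming distance one). The random site subgraph with parameter $p$ is the induced subgraph obtained by independently keeping each vertex (calling it occupied) with probability $p$ and removing it, together with all incident edges, with probability $1-p$. A vertex of the subgraph (i.e. an occupied vertex) is isolated if none of its neighbors is occupied. The giant component is the largest connected component of the random site subgraph. "Asymptotically almost surely" means with probability tending to $1$ as $n\to\infty$, with $d,a_1,\ldots,a_d,c$ fixed. *)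

theory Defs
  imports "HOL-Probability.Probability" "Graph_Theory.Graph_Theory"
begin

text \<open>
  Undirected simple graphs are represented, as usual in \<^theory>\<open>Graph_Theory.Digraph\<close>, by
  symmetric loop-free digraphs. A vertex is a function on \<open>{1..d}\<close>, extended by
  \<^const>\<open>undefined\<close> outside that set, so that distinct vertices differ in \<open>{1..d}\<close>.
\<close>

definition hamming_torus_verts :: "nat \<Rightarrow> (nat \<Rightarrow> real) \<Rightarrow> nat \<Rightarrow> (nat \<Rightarrow> int) set" where
  "hamming_torus_verts d a n =
     (\<Pi>\<^sub>E i\<in>{1..d}. {k::int. 1 \<le> k \<and> real_of_int k \<le> a i * real n})"

definition hamming_torus :: "nat \<Rightarrow> (nat \<Rightarrow> real) \<Rightarrow> nat \<Rightarrow> (nat \<Rightarrow> int) pair_pre_digraph" where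
  "hamming_torus d a n =
     \<lparr> pverts = hamming_torus_verts d a n,
       parcs = {(x, y). x \<in> hamming_torus_verts d a n \<and> y \<in> hamming_torus_verts d a n
                  \<and> card {i \<in> {1..d}. x i \<noteq> y i} = 1} \<rparr>"

lemma finite_hamming_torus_verts: "finite (hamming_torus_verts d a n)"
proof -
  have "{k::int. 1 \<le> k \<and> real_of_int k \<le> r} \<subseteq> {1..\<lfloor>r\<rfloor>}" for r
    by (auto simp: le_floor_iff)
  then have "finite {k::int. 1 \<le> k \<and> real_of_int k \<le> r}" for r
    by (rule finite_subset) simp
  then show ?thesis
    unfolding hamming_torus_verts_def by (intro finite_PiE) auto
qed

lemma pair_graph_hamming_torus: "pair_graph (hamming_torus d a n)"
proof
  let ?V = "hamming_torus_verts d a n"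
  show "finite (pverts (hamming_torus d a n))"
    by (simp add: hamming_torus_def finite_hamming_torus_verts)
  have "parcs (hamming_torus d a n) \<subseteq> ?V \<times> ?V"
    by (auto simp: hamming_torus_def)
  then show "finite (parcs (hamming_torus d a n))"
    by (rule finite_subset) (simp add: finite_hamming_torus_verts)
  have comm: "{i \<in> {1..d}. y i \<noteq> x i} = {i \<in> {1..d}. x i \<noteq> y i}" for x y :: "nat \<Rightarrow> int"
    by metis
  have "sym (parcs (hamming_torus d a n))"
    unfolding hamming_torus_def
    by (rule symI, simp only: pair_pre_digraph.simps mem_Collect_eq case_prod_conv)
      (metis comm)
  then show "symmetric (with_proj (hamming_torus d a n))"
    by (simp add: symmetric_def)
next
  fix e assume e: "e \<in> parcs (hamming_torus d a n)"
  then show "fst e \<in> pverts (hamming_torus d a n)"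
    by (simp add: hamming_torus_def split: prod.splits)
  from e show "snd e \<in> pverts (hamming_torus d a n)"
    by (simp add: hamming_torus_def split: prod.splits)
  from e show "fst e \<noteq> snd e"
    by (cases e) (simp add: hamming_torus_def, metis (mono_tags, lifting) card.empty empty_Collect_eq zero_neq_one One_nat_def)
qed

text \<open>
  Site percolation: each vertex is occupied independently with probability \<open>p\<close>.
  (\<^const>\<open>bernoulli_pmf\<close> truncates its parameter to \<open>[0,1]\<close>.)
\<close>

definition site_percolation ::
    "nat \<Rightarrow> (nat \<Rightarrow> real) \<Rightarrow> nat \<Rightarrow> real \<Rightarrow> ((nat \<Rightarrow> int) \<Rightarrow> bool) pmf" where
  "site_percolation d a n p =
     Pi_pmf (hamming_torus_verts d a n) False (\<lambda>_. bernoulli_pmf p)"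

definition site_subgraph ::
    "nat \<Rightarrow> (nat \<Rightarrow> real) \<Rightarrow> nat \<Rightarrow> ((nat \<Rightarrow> int) \<Rightarrow> bool)
       \<Rightarrow> (nat \<Rightarrow> int, (nat \<Rightarrow> int) \<times> (nat \<Rightarrow> int)) pre_digraph" where
  "site_subgraph d a n \<omega> =
     with_proj (hamming_torus d a n) \<restriction> {x \<in> hamming_torus_verts d a n. \<omega> x}"

definition isolated_vertex :: "('v, 'e) pre_digraph \<Rightarrow> 'v \<Rightarrow> bool" where
  "isolated_vertex G v \<longleftrightarrow> v \<in> verts G \<and> \<not> (\<exists>w. v \<rightarrow>\<^bsub>G\<^esub> w)"

text \<open>
  In a symmetric digraph the strongly connected components are the connected components.
  Being \<^emph>\<open>the\<close> largest component includes that no other component has the same size.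
\<close>

definition is_giant_component :: "('v, 'e) pre_digraph \<Rightarrow> 'v set \<Rightarrow> bool" where
  "is_giant_component G C \<longleftrightarrow>
     C \<in> pre_digraph.sccs_verts G \<and>
     (\<forall>C' \<in> pre_digraph.sccs_verts G. C' \<noteq> C \<longrightarrow> card C' < card C)"

end

theory Submission
  imports Defs "HOL-Real_Asymp.Real_Asymp"
begin

text \<open>
  Call a line (a set of sites that differ in one fixed coordinate only) rich if it contains at least
  \<open>\<eta> ln n\<close> occupied sites, \<open>\<eta>\<close> small. Two adjacent sites have at least
  \<open>(2 \<Sum>a\<^sub>i - a\<^sub>1) n - O(1)\<close> neighbours, so the assumption on \<open>c\<close> makes the expected number of
  occupied edges with few occupied neighbours tend to zero. Hence asymptotically almost surely, by the
  pigeonhole principle, an endpoint of every occupied edge lies on a rich line.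

  It remains to connect the rich lines. A coordinate plane is a random bipartite graph
  (rows against columns, occupied sites being edges) with edge probability of order \<open>ln n / n\<close>. Even
  simultaneously in all planes there is no vacant rectangle with sides proportional to \<open>n\<close>, so
  every plane with one row removed has a component that misses only a proportion \<open>\<epsilon>\<close> of the
  columns. These columns are independent of the removed row; if that row is rich, then with
  probability \<open>1 - O(1 / n ^ K)\<close>, for \<open>K\<close> as large as desired, some occupied site of it lies in
  a column that is not missed. So all rich lines of a plane are in the same component. Since most lines
  are rich, planes can be linked to each other through rich lines.
\<close>

section \<open>Rich lines in a product grid\<close>

text \<open>A line is given by its direction \<open>i\<close> and any point \<open>x\<close> on it:
  the value \<open>x i\<close> does not matter, and \<open>x\<close> itself may be vacant.\<close>

definition rich :: "('i \<Rightarrow> 'b set) \<Rightarrow> real \<Rightarrow> ('i \<Rightarrow> 'b) set \<Rightarrow> 'i \<Rightarrow> ('i \<Rightarrow> 'b) \<Rightarrow> bool" where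
  "rich I m X i x \<longleftrightarrow> m \<le> real (card {s \<in> I i. x(i := s) \<in> X})"

text \<open>\<open>S\<close> and \<open>T\<close> are arbitrary sets, not intervals. In the
  bipartite graph of the two coordinates of the plane, the condition excludes bipartite holes of
  proportion \<open>e\<close>.\<close>

definition no_vacant_rectangle ::
    "('i \<Rightarrow> 'b set) \<Rightarrow> real \<Rightarrow> ('i \<Rightarrow> 'b) set \<Rightarrow> 'i \<Rightarrow> 'i \<Rightarrow> ('i \<Rightarrow> 'b) \<Rightarrow> bool" where
  "no_vacant_rectangle I e X i j y \<longleftrightarrow>
     (\<forall>S T. S \<subseteq> I i \<longrightarrow> T \<subseteq> I j \<longrightarrow> e * real (card (I i)) \<le> real (card S) \<longrightarrow> e * real (card (I j)) \<le> real (card T) \<longrightarrow>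
        (\<exists>s\<in>S. \<exists>t\<in>T. y(i := s, j := t) \<in> X))"

text \<open>
  The plane through \<open>y\<close> in directions \<open>i\<close> and \<open>j\<close>, with the line through \<open>y\<close> in direction \<open>i\<close> left
  out, is a bipartite graph: its sides are the coordinates \<open>s\<close> and \<open>t\<close>, its edges the sites of \<open>X\<close>.
  A pair \<open>(S, T)\<close> that no site separates is a union of components of this graph.
\<close>

definition small_union ::
    "('i \<Rightarrow> 'b set) \<Rightarrow> real \<Rightarrow> ('i \<Rightarrow> 'b) set \<Rightarrow> 'i \<Rightarrow> 'i \<Rightarrow> ('i \<Rightarrow> 'b) \<Rightarrow> 'b set \<times> 'b set \<Rightarrow> bool" where
  "small_union I e X i j y = (\<lambda>(S, T). S \<subseteq> I i \<and> T \<subseteq> I j - {y j} \<and>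
     real (card S) < e * real (card (I i)) \<and> real (card T) < e * real (card (I j)) \<and>
     (\<forall>s\<in>I i. \<forall>t\<in>I j - {y j}. y(i := s, j := t) \<in> X \<longrightarrow> (s \<in> S \<longleftrightarrow> t \<in> T)))"

text \<open>Fixing one pair by \<open>SOME\<close> makes it a function of the configuration, so that
  it can be treated as a random variable.\<close>

definition max_small_union ::
    "('i \<Rightarrow> 'b set) \<Rightarrow> real \<Rightarrow> ('i \<Rightarrow> 'b) set \<Rightarrow> 'i \<Rightarrow> 'i \<Rightarrow> ('i \<Rightarrow> 'b) \<Rightarrow> 'b set \<times> 'b set" where
  "max_small_union I e X i j y = (SOME Z. small_union I e X i j y Z \<and>
     (\<forall>Z'. small_union I e X i j y Z' \<longrightarrow> card (fst Z') + card (snd Z') \<le> card (fst Z) + card (snd Z)))"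

lemma small_union_cong:
  assumes "\<And>s t. s \<in> I i \<Longrightarrow> t \<in> I j \<Longrightarrow> t \<noteq> y j \<Longrightarrow> y(i := s, j := t) \<in> X \<longleftrightarrow> y(i := s, j := t) \<in> X'"
  shows "small_union I e X i j y = small_union I e X' i j y"
  using assms unfolding small_union_def by (intro ext) (auto split: prod.splits)

text \<open>This is independence in deterministic form: changing the occupation of the line through
  \<open>y\<close> in direction \<open>i\<close> leaves the chosen pair unchanged.\<close>

lemma max_small_union_cong:
  assumes "\<And>s t. s \<in> I i \<Longrightarrow> t \<in> I j \<Longrightarrow> t \<noteq> y j \<Longrightarrow> y(i := s, j := t) \<in> X \<longleftrightarrow> y(i := s, j := t) \<in> X'"
  shows "max_small_union I e X i j y = max_small_union I e X' i j y"
  unfolding max_small_union_def using small_union_cong[of I i j y X X' e] assms by simp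

text \<open>A maximum exists because the pair of empty sets is small, by \<open>0 < e\<close> and
  the nonempty sides, and because all sizes are bounded by those of the sides.\<close>

lemma max_small_union:
  fixes e :: real
  assumes fin: "finite (I i)" "finite (I j)" and ne: "I i \<noteq> {}" "I j \<noteq> {}" and e: "0 < e"
  shows "small_union I e X i j y (max_small_union I e X i j y)"
    and "small_union I e X i j y Z \<Longrightarrow> card (fst Z) + card (snd Z) \<le>
           card (fst (max_small_union I e X i j y)) + card (snd (max_small_union I e X i j y))"
proof -
  let ?f = "\<lambda>Z. card (fst Z) + card (snd Z)"
  have 0: "small_union I e X i j y ({}, {})"
    using ne fin e by (auto simp: small_union_def card_gt_0_iff)
  have "?f Z \<le> card (I i) + card (I j)" if "small_union I e X i j y Z" for Z
  proof -
    have "fst Z \<subseteq> I i" "snd Z \<subseteq> I j" using that by (auto simp: small_union_def)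
    then show ?thesis using fin by (intro add_mono card_mono) auto
  qed
  with 0 have "\<exists>Z. small_union I e X i j y Z \<and> (\<forall>Z'. small_union I e X i j y Z' \<longrightarrow> ?f Z' \<le> ?f Z)"
    using ex_has_greatest_nat[of "small_union I e X i j y" "({}, {})" ?f "Suc (card (I i) + card (I j))"]
    by (simp add: less_Suc_eq_le)
  from someI_ex[OF this] show "small_union I e X i j y (max_small_union I e X i j y)"
    and "small_union I e X i j y Z \<Longrightarrow> ?f Z \<le> ?f (max_small_union I e X i j y)"
    unfolding max_small_union_def by blast+
qed

text \<open>Meant for adjacent \<open>u\<close> and \<open>v\<close>. The ends of the edge are
  removed so that the occupation of the rest is independent of theirs.\<close>

definition edge_nbhd :: "'i set \<Rightarrow> ('i \<Rightarrow> 'b set) \<Rightarrow> ('i \<Rightarrow> 'b) \<Rightarrow> ('i \<Rightarrow> 'b) \<Rightarrow> ('i \<Rightarrow> 'b) set" where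
  "edge_nbhd D I u v = (\<Union>i\<in>D. (\<lambda>s. u(i := s)) ` I i \<union> (\<lambda>s. v(i := s)) ` I i) - {u, v}"

text \<open>The relation \<open>r\<close> stands for reachability in the site subgraph. Reflexivity
  at occupied sites of the grid comes from \<open>line_r\<close> with \<open>s = t\<close>.\<close>

locale grid_classes =
  fixes D :: "'i set" and I :: "'i \<Rightarrow> 'b set" and X :: "('i \<Rightarrow> 'b) set"
    and r :: "('i \<Rightarrow> 'b) \<Rightarrow> ('i \<Rightarrow> 'b) \<Rightarrow> bool"
  assumes finite_D: "finite D" and finite_I: "\<And>i. i \<in> D \<Longrightarrow> finite (I i)"
    and card_I: "\<And>i. i \<in> D \<Longrightarrow> 2 \<le> card (I i)"
    and sym_r: "\<And>x y. r x y \<Longrightarrow> r y x"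
    and trans_r: "\<And>x y z. r x y \<Longrightarrow> r y z \<Longrightarrow> r x z"
    and line_r: "\<And>i x s t. i \<in> D \<Longrightarrow> x \<in> PiE D I \<Longrightarrow> s \<in> I i \<Longrightarrow> t \<in> I i \<Longrightarrow>
      x(i := s) \<in> X \<Longrightarrow> x(i := t) \<in> X \<Longrightarrow> r (x(i := s)) (x(i := t))"
begin

lemma upd_in: "x \<in> PiE D I \<Longrightarrow> i \<in> D \<Longrightarrow> s \<in> I i \<Longrightarrow> x(i := s) \<in> PiE D I"
  by (auto simp: PiE_def extensional_def)

text \<open>
  Adding the class of \<open>y(i := s0)\<close> to the maximal small union gives a larger union of components,
  which by maximality is not small; without vacant rectangles it then is almost everything.
\<close>

lemma spread:
  fixes e :: real
  assumes ij: "i \<in> D" "j \<in> D" "i \<noteq> j" and y: "y \<in> PiE D I" and e: "0 < e" "e \<le> 1/4"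
    and rect: "no_vacant_rectangle I e X i j y"
    and s0: "s0 \<in> I i" "s0 \<notin> fst (max_small_union I e X i j y)" "y(i := s0) \<in> X"
  defines "K \<equiv> (\<lambda>s t. y(i := s, j := t) \<in> X \<and> r (y(i := s0)) (y(i := s, j := t)))"
  shows "card {s \<in> I i. \<not> (\<exists>t\<in>I j. K s t)} < 2 * e * card (I i)"
    and "card {t \<in> I j. \<not> (\<exists>s\<in>I i. K s t)} < 2 * e * card (I j)"
proof -
  have fin: "finite (I i)" "finite (I j)" using finite_I ij by auto
  have c2: "2 \<le> card (I i)" "2 \<le> card (I j)" using card_I ij by auto
  then have ne: "I i \<noteq> {}" "I j \<noteq> {}" by auto
  obtain S T where ST: "max_small_union I e X i j y = (S, T)" by fastforce
  have su: "small_union I e X i j y (S, T)"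
    using max_small_union(1)[of I i j e X y] fin ne e by (simp add: ST)
  have mx: "card S' + card T' \<le> card S + card T" if "small_union I e X i j y (S', T')" for S' T'
    using max_small_union(2)[of I i j e X y "(S', T')"] that fin ne e by (simp add: ST)
  have yj: "y j \<in> I j" using y ij by auto
  have yj': "y(i := s, j := y j) = y(i := s)" for s using ij by auto
  \<comment> \<open>The class meets \<open>s0\<close> on the line that \<open>small_union\<close>
    leaves out, so \<open>s0\<close> lies in \<open>A\<close> although \<open>y j\<close> is not in
    \<open>B\<close>.\<close>
  have K0: "K s0 (y j)"
    using s0 ij y line_r[of i y s0 s0] unfolding K_def by (simp only: yj')
  define A where "A = {s \<in> I i. \<exists>t\<in>I j. K s t}"
  define B where "B = {t \<in> I j - {y j}. \<exists>s\<in>I i. K s t}"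
  \<comment> \<open>Occupied sites on a common line are related, so \<open>(A, B)\<close> is again a
    union of components.\<close>
  have closed: "s \<in> A \<longleftrightarrow> t \<in> B" if st: "s \<in> I i" "t \<in> I j - {y j}" "y(i := s, j := t) \<in> X" for s t
  proof
    assume "s \<in> A"
    then obtain t' where t': "t' \<in> I j" "K s t'" by (auto simp: A_def)
    have "r (y(i := s, j := t')) (y(i := s, j := t))"
      using line_r[of j "y(i := s)" t' t] t' st ij upd_in[OF y ij(1) st(1)] by (auto simp: K_def)
    then have "K s t" using t' st unfolding K_def by (blast intro: trans_r)
    then show "t \<in> B" using st by (auto simp: B_def)
  next
    assume "t \<in> B"
    then obtain s' where s': "s' \<in> I i" "K s' t" by (auto simp: B_def)
    have tw: "y(j := t, i := u) = y(i := u, j := t)" for u using ij by (simp add: fun_upd_twist)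
    have "r (y(i := s', j := t)) (y(i := s, j := t))"
      using line_r[of i "y(j := t)" s' s] s' st ij upd_in[OF y ij(2), of t] by (auto simp: K_def tw)
    then have "K s t" using s' st unfolding K_def by (blast intro: trans_r)
    then show "s \<in> A" using st by (auto simp: A_def)
  qed
  let ?S = "S \<union> A" and ?T = "T \<union> B"
  have sub: "?S \<subseteq> I i" "?T \<subseteq> I j - {y j}" using su by (auto simp: small_union_def A_def B_def)
  have finS: "finite ?S" "finite ?T" using sub fin by (auto intro: finite_subset)
  have cl: "s \<in> ?S \<longleftrightarrow> t \<in> ?T" if "s \<in> I i" "t \<in> I j - {y j}" "y(i := s, j := t) \<in> X" for s t
    using closed[OF that] su that by (auto simp: small_union_def)
  have "s0 \<in> ?S - S" using s0 K0 yj by (auto simp: A_def ST)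
  then have "S \<subset> ?S" by auto
  then have "card S < card ?S" using finS by (intro psubset_card_mono) auto
  moreover have "card T \<le> card ?T" using finS by (intro card_mono) auto
  ultimately have "\<not> small_union I e X i j y (?S, ?T)" using mx by fastforce
  then have big: "e * card (I i) \<le> card ?S \<or> e * card (I j) \<le> card ?T"
    using sub cl unfolding small_union_def split_conv not_less[symmetric] by blast
  have cS: "real (card (I i)) = card ?S + card (I i - ?S)"
    using sub fin by (subst card_Diff_subset) (auto simp: card_mono intro: finite_subset)
  have "card (I j - {y j} - ?T) = card (I j) - 1 - card ?T"
    using sub fin finS yj by (subst card_Diff_subset) auto
  moreover have "card ?T \<le> card (I j) - 1"
    using card_mono[OF _ sub(2)] fin yj by simp
  \<comment> \<open>The extra 1 counts the left-out coordinate \<open>y j\<close>, which lies in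
    neither part.\<close>
  ultimately have cT: "real (card (I j)) = card ?T + card (I j - {y j} - ?T) + 1"
    using c2 by linarith
  have e4: "e * card (I i) \<le> card (I i) / 4" "e * card (I j) \<le> card (I j) / 4"
    using mult_right_mono[OF e(2), of "real (card (I i))"] mult_right_mono[OF e(2), of "real (card (I j))"] by auto
  have c2': "real (card (I i)) \<ge> 2" "real (card (I j)) \<ge> 2" using c2 by auto
  have r1: "card (I j - {y j} - ?T) < e * card (I j)" if big1: "e * card (I i) \<le> card ?S"
  proof (rule ccontr)
    assume "\<not> ?thesis"
    then obtain s t where "s \<in> ?S" "t \<in> I j - {y j} - ?T" "y(i := s, j := t) \<in> X"
      using rect[unfolded no_vacant_rectangle_def, rule_format, of "?S" "I j - {y j} - ?T"] big1 sub
      unfolding not_less by blast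
    then show False using cl[of s t] sub by auto
  qed
  have r2: "card (I i - ?S) < e * card (I i)" if big1: "e * card (I j) \<le> card ?T"
  proof (rule ccontr)
    assume "\<not> ?thesis"
    then obtain s t where "s \<in> I i - ?S" "t \<in> ?T" "y(i := s, j := t) \<in> X"
      using rect[unfolded no_vacant_rectangle_def, rule_format, of "I i - ?S" "?T"] big1 sub
      unfolding not_less by blast
    then show False using cl[of s t] sub by auto
  qed
  \<comment> \<open>If one side reaches the proportion \<open>e\<close>, the other misses less than
    a quarter of its elements and possibly \<open>y j\<close>, which is at most half of them. At
    least a quarter remains, so both sides reach the proportion \<open>e\<close>.\<close>
  have "e * card (I j) \<le> card ?T" if "e * card (I i) \<le> card ?S"
    using r1[OF that] cT e4 c2' by linarith
  moreover have "e * card (I i) \<le> card ?S" if "e * card (I j) \<le> card ?T"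
    using r2[OF that] cS e4 c2' by linarith
  ultimately have "e * card (I i) \<le> card ?S" "e * card (I j) \<le> card ?T" using big by auto
  note R = r1[OF this(1)] r2[OF this(2)]
  have small: "card S < e * card (I i)" "card T < e * card (I j)" using su by (auto simp: small_union_def)
  \<comment> \<open>What the class misses lies outside the large union or inside the old small one;
    each accounts for a proportion below \<open>e\<close>.\<close>
  have "{s \<in> I i. \<not> (\<exists>t\<in>I j. K s t)} \<subseteq> (I i - ?S) \<union> S" by (auto simp: A_def)
  then have "card {s \<in> I i. \<not> (\<exists>t\<in>I j. K s t)} \<le> card (I i - ?S) + card S"
    using fin finS by (meson card_Un_le card_mono finite_Diff finite_Un le_trans)
  then show "card {s \<in> I i. \<not> (\<exists>t\<in>I j. K s t)} < 2 * e * card (I i)" using R small by linarith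
  have "{t \<in> I j. \<not> (\<exists>s\<in>I i. K s t)} \<subseteq> (I j - {y j} - ?T) \<union> T" using K0 s0 by (auto simp: B_def)
  then have "card {t \<in> I j. \<not> (\<exists>s\<in>I i. K s t)} \<le> card (I j - {y j} - ?T) + card T"
    using fin finS by (meson card_Un_le card_mono finite_Diff finite_Un le_trans)
  then show "card {t \<in> I j. \<not> (\<exists>s\<in>I i. K s t)} < 2 * e * card (I j)" using R small by linarith
qed

end

text \<open>These are the deterministic properties from which connectedness follows. The factor
  \<open>2 * card D\<close> counts the lines through the two ends of an edge, their common line
  twice. With \<open>e \<le> 1/4\<close>, a class obtained from \<open>spread\<close> misses less
  than half of each side, so two of them overlap.\<close>

locale good_grid = grid_classes D I X r
  for D :: "'i set" and I :: "'i \<Rightarrow> 'b set" and X r +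
  fixes e m :: real
  assumes e: "0 < e" "e \<le> 1/4" and m: "1 < m" and X_sub: "X \<subseteq> PiE D I"
    and dense_edges: "\<And>k v s. k \<in> D \<Longrightarrow> v \<in> X \<Longrightarrow> s \<in> I k \<Longrightarrow> s \<noteq> v k \<Longrightarrow> v(k := s) \<in> X \<Longrightarrow>
      2 * real (card D) * m \<le> card {x \<in> edge_nbhd D I v (v(k := s)). x \<in> X}"
    and rich_pair: "\<And>i j x y. i \<in> D \<Longrightarrow> j \<in> D \<Longrightarrow> i \<noteq> j \<Longrightarrow> x \<in> PiE D I \<Longrightarrow> y \<in> PiE D I \<Longrightarrow>
      \<exists>t\<in>I j. rich I m X i (x(j := t)) \<and> rich I m X i (y(j := t))"
    and rect: "\<And>i j y. i \<in> D \<Longrightarrow> j \<in> D \<Longrightarrow> i \<noteq> j \<Longrightarrow> y \<in> PiE D I \<Longrightarrow> no_vacant_rectangle I e X i j y"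
    and few_exceptions: "\<And>i j y. i \<in> D \<Longrightarrow> j \<in> D \<Longrightarrow> i \<noteq> j \<Longrightarrow> y \<in> PiE D I \<Longrightarrow>
      card {s \<in> fst (max_small_union I e X i j y). y(i := s) \<in> X} < m"
begin

definition joined :: "'i \<Rightarrow> ('i \<Rightarrow> 'b) \<Rightarrow> 'i \<Rightarrow> ('i \<Rightarrow> 'b) \<Rightarrow> bool" where
  "joined i x k z \<longleftrightarrow> (\<forall>s\<in>I i. \<forall>t\<in>I k. x(i := s) \<in> X \<longrightarrow> z(k := t) \<in> X \<longrightarrow> r (x(i := s)) (z(k := t)))"

section \<open>Joining rich lines inside a plane and across planes\<close>

lemma rich_cong: "(\<And>s. x(i := s) = y(i := s)) \<Longrightarrow> rich I m X i x \<longleftrightarrow> rich I m X i y"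
  by (simp add: rich_def)

lemma rich_nonempty:
  assumes "rich I m X i x"
  obtains s where "s \<in> I i" "x(i := s) \<in> X"
proof -
  have "card {s \<in> I i. x(i := s) \<in> X} \<noteq> 0" using assms m by (auto simp: rich_def)
  then have "{s \<in> I i. x(i := s) \<in> X} \<noteq> {}" by (metis card.empty)
  then show thesis using that by blast
qed

text \<open>\<open>joined\<close> holds vacuously for vacant lines, so the middle line has to carry
  an occupied site; richness provides one.\<close>

lemma joined_trans:
  assumes "joined i x j y" "rich I m X j y" "joined j y k z" shows "joined i x k z"
proof -
  obtain u where "u \<in> I j" "y(j := u) \<in> X" using rich_nonempty assms(2) by blast
  then show ?thesis using assms(1,3) unfolding joined_def by (blast intro: trans_r)
qed

text \<open>Fewer than \<open>m\<close> occupied sites of the line lie in the exceptional set, so a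
  rich line has one, \<open>s0\<close>, outside it. The lemma \<open>spread\<close> applies to
  \<open>s0\<close>, and \<open>s1\<close> lies in the same class because it is on the same
  line.\<close>

lemma rich_spread:
  assumes ij: "i \<in> D" "j \<in> D" "i \<noteq> j" and y: "y \<in> PiE D I" and rich: "rich I m X i y"
    and w: "s1 \<in> I i" "y(i := s1) \<in> X"
  defines "K \<equiv> (\<lambda>s t. y(i := s, j := t) \<in> X \<and> r (y(i := s1)) (y(i := s, j := t)))"
  shows "real (card {s \<in> I i. \<not> (\<exists>t\<in>I j. K s t)}) < card (I i) / 2"
    and "real (card {t \<in> I j. \<not> (\<exists>s\<in>I i. K s t)}) < card (I j) / 2"
proof -
  let ?Z = "fst (max_small_union I e X i j y)"
  have "{s \<in> I i. y(i := s) \<in> X} \<noteq> {s \<in> ?Z. y(i := s) \<in> X}"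
    using few_exceptions[OF ij y] rich unfolding rich_def by auto
  moreover have "?Z \<subseteq> I i"
  proof -
    have "I i \<noteq> {}" "I j \<noteq> {}" using card_I[of i] card_I[of j] ij by auto
    then show ?thesis
      using max_small_union(1)[of I i j e X y] finite_I ij e by (auto simp: small_union_def)
  qed
  ultimately obtain s0 where s0: "s0 \<in> I i" "s0 \<notin> ?Z" "y(i := s0) \<in> X" by blast
  have r01: "r (y(i := s1)) (y(i := s0))" using line_r[of i y s1 s0] ij y w s0 by blast
  have K: "K s t \<longleftrightarrow> y(i := s, j := t) \<in> X \<and> r (y(i := s0)) (y(i := s, j := t))" for s t
    unfolding K_def using r01 by (blast intro: trans_r sym_r)
  have "2 * e * card (I i) \<le> card (I i) / 2" "2 * e * card (I j) \<le> card (I j) / 2"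
    using mult_right_mono[OF e(2), of "real (card (I i))"] mult_right_mono[OF e(2), of "real (card (I j))"] by auto
  moreover note spread[OF ij y e rect[OF ij y] s0]
  ultimately show "real (card {s \<in> I i. \<not> (\<exists>t\<in>I j. K s t)}) < card (I i) / 2"
    and "real (card {t \<in> I j. \<not> (\<exists>s\<in>I i. K s t)}) < card (I j) / 2"
    unfolding K by linarith+
qed

text \<open>Two classes that each miss less than half of the coordinates \<open>s\<close> meet a
  common one. The line in direction \<open>j\<close> over it contains sites of both classes and
  identifies them.\<close>

lemma common_column:
  assumes ij: "i \<in> D" "j \<in> D" "i \<noteq> j" and y: "y \<in> PiE D I"
    and "real (card {s \<in> I i. \<not> (\<exists>t\<in>I j. y(i := s, j := t) \<in> X \<and> r w (y(i := s, j := t)))}) < card (I i) / 2"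
    and "real (card {s \<in> I i. \<not> (\<exists>t\<in>I j. y(i := s, j := t) \<in> X \<and> r w' (y(i := s, j := t)))}) < card (I i) / 2"
  shows "r w w'"
proof -
  let ?A = "\<lambda>w. {s \<in> I i. \<not> (\<exists>t\<in>I j. y(i := s, j := t) \<in> X \<and> r w (y(i := s, j := t)))}"
  have "card (?A w \<union> ?A w') < card (I i)"
    using card_Un_le[of "?A w" "?A w'"] assms(5,6) by linarith
  then have "?A w \<union> ?A w' \<noteq> I i" by (metis less_irrefl)
  then obtain s where "s \<in> I i" "s \<notin> ?A w" "s \<notin> ?A w'" by blast
  then obtain t t' where t: "t \<in> I j" "y(i := s, j := t) \<in> X" "r w (y(i := s, j := t))"
    "t' \<in> I j" "y(i := s, j := t') \<in> X" "r w' (y(i := s, j := t'))" by auto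
  have "r (y(i := s, j := t)) (y(i := s, j := t'))"
    using line_r[of j "y(i := s)" t t'] t ij upd_in[OF y ij(1) \<open>s \<in> I i\<close>] by blast
  then show ?thesis using t by (blast intro: trans_r sym_r)
qed

text \<open>Both lines lie in one plane, and each spreads over more than half of its
  columns.\<close>

lemma joined_parallel:
  assumes ij: "i \<in> D" "j \<in> D" "i \<noteq> j" and y: "y \<in> PiE D I" and t: "t \<in> I j"
    and rich: "rich I m X i y" "rich I m X i (y(j := t))"
  shows "joined i y i (y(j := t))"
  unfolding joined_def
proof (intro ballI impI)
  fix s s' assume s: "s \<in> I i" "s' \<in> I i" "y(i := s) \<in> X" "y(j := t, i := s') \<in> X"
  \<comment> \<open>The plane through \<open>y(j := t)\<close> is the plane through
    \<open>y\<close>; only the left-out line differs.\<close>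
  have tw: "y(j := t, i := u, j := t') = y(i := u, j := t')" for u t'
    using ij by (auto simp: fun_eq_iff)
  show "r (y(i := s)) (y(j := t, i := s'))"
    by (rule common_column[OF ij y rich_spread(1)[OF ij y rich(1) s(1,3)]
      rich_spread(1)[OF ij upd_in[OF y ij(2) t] rich(2) s(2,4), unfolded tw]])
qed

text \<open>For the second line \<open>rich_spread\<close> is used with the two directions
  exchanged; its second conclusion then counts the same columns as the first conclusion for the
  first line.\<close>

lemma joined_crossing:
  assumes ij: "i \<in> D" "j \<in> D" "i \<noteq> j" and y: "y \<in> PiE D I"
    and rich: "rich I m X i y" "rich I m X j y"
  shows "joined i y j y"
  unfolding joined_def
proof (intro ballI impI)
  fix s s' assume s: "s \<in> I i" "s' \<in> I j" "y(i := s) \<in> X" "y(j := s') \<in> X"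
  have tw: "y(j := t, i := u) = y(i := u, j := t)" for u t
    using ij by (auto simp: fun_eq_iff)
  show "r (y(i := s)) (y(j := s'))"
    by (rule common_column[OF ij y rich_spread(1)[OF ij y rich(1) s(1,3)]
      rich_spread(2)[OF ij(2,1) ij(3)[symmetric] y rich(2) s(2,4), unfolded tw]])
qed

text \<open>Induction on the number of coordinates other than \<open>i\<close> in which the lines
  differ. No difference means the same line, one difference a common plane.\<close>

lemma joined_same_direction:
  assumes i: "i \<in> D" and x: "x \<in> PiE D I" and z: "z \<in> PiE D I"
    and rich: "rich I m X i x" "rich I m X i z"
  shows "joined i x i z"
  using x rich(1)
proof (induction "card {k \<in> D - {i}. x k \<noteq> z k}" arbitrary: x rule: less_induct)
  case (less x)
  let ?N = "\<lambda>x. {k \<in> D - {i}. x k \<noteq> z k}"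
  have finN: "finite (?N x)" for x using finite_D by auto
  have outside: "x k = z k" if "k \<notin> D" for k
    using that less.prems(1) z by (simp add: PiE_def extensional_def)
  consider "?N x = {}" | k where "?N x = {k}" | j k where "j \<noteq> k" "j \<in> ?N x" "k \<in> ?N x" by blast
  then show ?case
  proof cases
    case 1
    then have "x(i := s) = z(i := s)" for s using outside by (auto simp: fun_eq_iff)
    then show ?thesis using line_r[OF i z] unfolding joined_def by simp
  next
    case 2
    then have k: "k \<in> D" "i \<noteq> k" by auto
    have eq: "x(k := z k, i := s) = z(i := s)" for s
    proof
      fix l
      have "l = i \<or> l = k \<or> x l = z l" using 2 outside by blast
      then show "(x(k := z k, i := s)) l = (z(i := s)) l" using k by auto
    qed
    have "joined i x i (x(k := z k))"
      using rich_cong[OF eq] rich(2) k z less.prems i by (intro joined_parallel) auto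
    then show ?thesis by (simp add: joined_def eq)
  next
    case 3
    then have jk: "j \<in> D" "k \<in> D" "i \<noteq> j" "i \<noteq> k" by auto
    have zk: "z k \<in> I k" using z jk by auto
    \<comment> \<open>Correcting coordinate \<open>k\<close> at once could lead to a line that is
      not rich. So coordinate \<open>j\<close> is first moved to a value at which the lines before
      and after the correction are both rich. Since \<open>j\<close> differed already, the number of
      differences still drops.\<close>
    obtain t where t: "t \<in> I j" "rich I m X i (x(j := t))" "rich I m X i (x(k := z k, j := t))"
      using rich_pair[OF i jk(1) jk(3) less.prems(1) upd_in[OF less.prems(1) jk(2) zk]] by blast
    let ?w = "x(j := t, k := z k)"
    have w: "?w = x(k := z k, j := t)" using 3(1) by (auto simp: fun_eq_iff)
    have xj: "x(j := t) \<in> PiE D I" using upd_in less.prems(1) jk t by auto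
    have "joined i x i (x(j := t))" by (rule joined_parallel) (use i jk less.prems t in auto)
    moreover have "joined i (x(j := t)) i ?w"
      by (rule joined_parallel) (use i jk xj t zk w in auto)
    moreover have "joined i ?w i z"
    proof (rule less.hyps)
      have "?N ?w \<subset> ?N x" using 3 by auto
      then show "card (?N ?w) < card (?N x)" using finN by (intro psubset_card_mono) auto
    qed (use upd_in[OF xj jk(2) zk] t w in auto)
    ultimately show ?thesis using t w joined_trans by metis
  qed
qed

text \<open>For different directions, two values from \<open>rich_pair\<close> give a point
  \<open>?y\<close> through which the lines in both directions are rich. The lines cross there, and
  each is parallel to one of the given lines.\<close>

lemma rich_lines_joined:
  assumes ik: "i \<in> D" "k \<in> D" and x: "x \<in> PiE D I" and z: "z \<in> PiE D I"
    and rich: "rich I m X i x" "rich I m X k z"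
  shows "joined i x k z"
proof (cases "i = k")
  case True
  then show ?thesis using joined_same_direction assms by blast
next
  case False
  obtain t where t: "t \<in> I k" "rich I m X i (x(k := t))" using rich_pair[OF ik False x x] by auto
  obtain s where s: "s \<in> I i" "rich I m X k (x(i := s))"
    using rich_pair[OF ik(2) ik(1) not_sym[OF False] x x] by auto
  let ?y = "x(i := s, k := t)"
  have y: "?y \<in> PiE D I" by (intro upd_in x ik s t)
  have r1: "rich I m X i ?y" using t(2) False by (subst rich_cong[of _ _ "x(k := t)"]) (auto simp: fun_eq_iff)
  have r2: "rich I m X k ?y" using s(2) by (subst rich_cong[of _ _ "x(i := s)"]) auto
  have "joined i x i ?y" by (rule joined_same_direction) (use ik x y rich r1 in auto)
  moreover have "joined i ?y k ?y" by (rule joined_crossing) (use ik y False r1 r2 in auto)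
  moreover have "joined k ?y k z" by (rule joined_same_direction) (use ik z y rich r2 in auto)
  ultimately show ?thesis using r1 r2 joined_trans by blast
qed

text \<open>Pigeonhole: if no line through the ends of the edge were rich, the neighbourhood would
  have fewer than \<open>2 * card D * m\<close> occupied sites. The site \<open>x\<close> found is
  one of the two ends.\<close>

lemma near_rich_line:
  assumes k: "k \<in> D" "v \<in> X" "s \<in> I k" "s \<noteq> v k" "v(k := s) \<in> X"
  obtains i x where "i \<in> D" "x \<in> PiE D I" "rich I m X i x" "x \<in> X" "r v x"
proof -
  let ?u = "v(k := s)"
  have v: "v \<in> PiE D I" using k X_sub by auto
  have "\<exists>i\<in>D. rich I m X i ?u \<or> rich I m X i v"
  proof (rule ccontr)
    assume "\<not> ?thesis"
    then have nr: "card {s \<in> I i. ?u(i := s) \<in> X} < m" "card {s \<in> I i. v(i := s) \<in> X} < m" if "i \<in> D" for i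
      using that by (auto simp: rich_def)
    let ?L = "\<lambda>x i. (\<lambda>s. x(i := s)) ` {s \<in> I i. x(i := s) \<in> X}"
    have fin: "finite (?L x i)" if "i \<in> D" for x i using finite_I that by auto
    have "{x \<in> edge_nbhd D I v ?u. x \<in> X} \<subseteq> (\<Union>i\<in>D. ?L ?u i \<union> ?L v i)"
      by (auto simp: edge_nbhd_def)
    then have "card {x \<in> edge_nbhd D I v ?u. x \<in> X} \<le> card (\<Union>i\<in>D. ?L ?u i \<union> ?L v i)"
      using finite_D fin by (intro card_mono) auto
    also have "\<dots> \<le> (\<Sum>i\<in>D. card (?L ?u i \<union> ?L v i))" by (rule card_UN_le[OF finite_D])
    finally have "real (card {x \<in> edge_nbhd D I v ?u. x \<in> X}) \<le> (\<Sum>i\<in>D. real (card (?L ?u i \<union> ?L v i)))"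
      by (simp flip: of_nat_sum)
    also have "\<dots> < (\<Sum>i\<in>D. 2 * m)"
    proof (rule sum_strict_mono)
      fix i assume i: "i \<in> D"
      have "card (?L x i) \<le> card {s \<in> I i. x(i := s) \<in> X}" for x
        using finite_I[OF i] by (intro card_image_le) auto
      from this[of ?u] this[of v] show "real (card (?L ?u i \<union> ?L v i)) < 2 * m"
        using card_Un_le[of "?L ?u i" "?L v i"] nr[OF i] by linarith
    qed (use finite_D k in auto)
    finally show False using dense_edges[OF k] by simp
  qed
  then obtain i x where x: "i \<in> D" "rich I m X i x" "x = ?u \<or> x = v" by blast
  have vk: "v k \<in> I k" using v k(1) by (rule PiE_mem)
  have "r v ?u" using line_r[OF k(1) v vk k(3)] k(2,5) by simp
  moreover have "r v v" using line_r[OF k(1) v vk vk] k(2) by simp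
  ultimately have "r v x" "x \<in> X" using x(3) k(2,5) by auto
  then show thesis using that x(1,2) X_sub by (metis subsetD)
qed

text \<open>The second site \<open>w'\<close> certifies that the class has at least two elements,
  which makes its component larger than that of an isolated vertex.\<close>

lemma single_class:
  assumes i0: "i0 \<in> D" and x0: "x0 \<in> PiE D I" and rich0: "rich I m X i0 x0"
  obtains w w' where "w \<in> X" "w' \<in> X" "w \<noteq> w'" "r w w'"
    "\<And>v k s. v \<in> X \<Longrightarrow> k \<in> D \<Longrightarrow> s \<in> I k \<Longrightarrow> s \<noteq> v k \<Longrightarrow> v(k := s) \<in> X \<Longrightarrow> r w v"
proof -
  let ?Z = "{s \<in> I i0. x0(i0 := s) \<in> X}"
  have "1 < card ?Z" using rich0 m by (simp add: rich_def)
  moreover have "finite ?Z" using finite_I[OF i0] by simp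
  ultimately have "\<not> (\<forall>s\<in>?Z. \<forall>s'\<in>?Z. s = s')" using card_le_Suc0_iff_eq[of ?Z] by linarith
  then obtain s s' where s: "s \<in> ?Z" "s' \<in> ?Z" "s \<noteq> s'" by blast
  have "r (x0(i0 := s)) v" if v: "v \<in> X" "k \<in> D" "t \<in> I k" "t \<noteq> v k" "v(k := t) \<in> X" for v k t
  proof -
    obtain i x where x: "i \<in> D" "x \<in> PiE D I" "rich I m X i x" "x \<in> X" "r v x"
      using near_rich_line[OF v(2,1,3,4,5)] by blast
    have xi: "x i \<in> I i" using x(2,1) by (rule PiE_mem)
    have "joined i0 x0 i x" by (rule rich_lines_joined[OF i0 x(1) x0 x(2) rich0 x(3)])
    then have "r (x0(i0 := s)) (x(i := x i))" using s(1) xi x(4) unfolding joined_def by (metis (no_types, lifting) fun_upd_triv mem_Collect_eq)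
    then show ?thesis using x(5) by (auto intro: trans_r sym_r)
  qed
  moreover have "r (x0(i0 := s)) (x0(i0 := s'))" using s line_r[OF i0 x0] by simp
  moreover have "x0(i0 := s) \<noteq> x0(i0 := s')" using s(3) by (metis fun_upd_same)
  moreover have "x0(i0 := s) \<in> X" "x0(i0 := s') \<in> X" using s(1,2) by auto
  ultimately show thesis using that by blast
qed

end

section \<open>Tail bounds for site percolation\<close>

abbreviation site_pmf :: "'v set \<Rightarrow> real \<Rightarrow> ('v \<Rightarrow> bool) pmf" where
  "site_pmf V p \<equiv> Pi_pmf V False (\<lambda>_. bernoulli_pmf p)"

lemma finite_set_pmf_site:
  assumes "finite V" shows "finite (set_pmf (site_pmf V p))"
  by (rule finite_subset[OF set_Pi_pmf_subset'[OF assms] finite_PiE_dflt[OF assms]]) simp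

text \<open>The integrand is a product of factors that each depend on one site, so by independence
  its expectation is the product of the single expectations.\<close>

lemma expectation_occupied:
  fixes p \<theta> :: real
  assumes V: "finite V" and p: "0 \<le> p" "p \<le> 1" and th: "0 \<le> \<theta>"
    and UL: "U \<subseteq> V" "L \<subseteq> V" "U \<inter> L = {}"
  shows "measure_pmf.expectation (site_pmf V p) (\<lambda>\<omega>. of_bool (\<forall>x\<in>U. \<omega> x) * \<theta> ^ card {x \<in> L. \<omega> x})
       = p ^ card U * (1 - p + p * \<theta>) ^ card L"
proof -
  define f where "f = (\<lambda>x b. if x \<in> U then of_bool b else if x \<in> L then (if b then \<theta> else 1) else (1::real))"
  have fin: "finite U" "finite L" using UL V by (auto intro: finite_subset)
  have split: "(\<Prod>x\<in>V. g x) = (\<Prod>x\<in>U. g x) * (\<Prod>x\<in>L. g x)"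
    if "\<And>x. x \<notin> U \<Longrightarrow> x \<notin> L \<Longrightarrow> g x = 1" for g :: "_ \<Rightarrow> real"
  proof -
    have "(\<Prod>x\<in>V. g x) = (\<Prod>x\<in>U \<union> L. g x)"
      using UL V that by (intro prod.mono_neutral_right) auto
    then show ?thesis using fin UL by (simp add: prod.union_disjoint)
  qed
  have eq: "of_bool (\<forall>x\<in>U. \<omega> x) * \<theta> ^ card {x \<in> L. \<omega> x} = (\<Prod>x\<in>V. f x (\<omega> x))" for \<omega>
  proof -
    have "(\<Prod>x\<in>V. f x (\<omega> x)) = (\<Prod>x\<in>U. f x (\<omega> x)) * (\<Prod>x\<in>L. f x (\<omega> x))"
      by (rule split) (auto simp: f_def)
    also have "(\<Prod>x\<in>U. f x (\<omega> x)) = (\<Prod>x\<in>U. of_bool (\<omega> x))"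
      by (rule prod.cong) (auto simp: f_def)
    also have "\<dots> = of_bool (\<forall>x\<in>U. \<omega> x)"
      using fin(1) by (induction U rule: finite_induct) auto
    also have "(\<Prod>x\<in>L. f x (\<omega> x)) = (\<Prod>x\<in>L. if \<omega> x then \<theta> else 1)"
      using UL by (intro prod.cong) (auto simp: f_def)
    also have "\<dots> = \<theta> ^ card {x \<in> L. \<omega> x}"
      using fin(2) by (simp add: prod.If_cases Int_def)
    finally show ?thesis by simp
  qed
  have E: "measure_pmf.expectation (bernoulli_pmf p) (f x) =
      (if x \<in> U then p else if x \<in> L then 1 - p + p * \<theta> else 1)" for x
    using p by (simp add: f_def)
  have prodL: "(\<Prod>x\<in>L. if x \<in> U then p else if x \<in> L then 1 - p + p * \<theta> else 1) = (\<Prod>x\<in>L. 1 - p + p * \<theta>)"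
    using UL(3) by (intro prod.cong) auto
  have "measure_pmf.expectation (site_pmf V p) (\<lambda>\<omega>. \<Prod>x\<in>V. f x (\<omega> x)) =
      (\<Prod>x\<in>V. measure_pmf.expectation (bernoulli_pmf p) (f x))"
    using V th by (intro expectation_prod_Pi_pmf)
      (auto simp: f_def intro!: integrable_measure_pmf_finite)
  also have "\<dots> = (\<Prod>x\<in>U. p) * (\<Prod>x\<in>L. 1 - p + p * \<theta>)"
    unfolding E prodL[symmetric] by (subst split) auto
  finally show ?thesis by (simp add: eq)
qed

lemma mgf_bound:
  fixes p \<theta> :: real
  assumes "0 \<le> p" "p \<le> 1" "0 \<le> \<theta>"
  shows "(1 - p + p * \<theta>) ^ k \<le> exp ((\<theta> - 1) * p * k)"
proof -
  have "1 - p + p * \<theta> \<le> exp ((\<theta> - 1) * p)"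
    using exp_ge_add_one_self[of "(\<theta> - 1) * p"] by (simp add: algebra_simps)
  then have "(1 - p + p * \<theta>) ^ k \<le> exp ((\<theta> - 1) * p) ^ k"
    using assms by (intro power_mono) auto
  then show ?thesis by (simp add: exp_of_nat_mult[symmetric] mult_ac)
qed

text \<open>Exponential Markov inequality. The hypothesis compares powers of \<theta> instead of
  counts, so that it covers the lower tail with \<theta> \<le> 1 and the upper tail with \<theta>
  \<ge> 1.\<close>

lemma markov_occupied:
  fixes p \<theta> s :: real
  assumes V: "finite V" and p: "0 \<le> p" "p \<le> 1" and th: "0 < \<theta>"
    and UL: "U \<subseteq> V" "L \<subseteq> V" "U \<inter> L = {}"
    and A: "\<And>\<omega>. \<omega> \<in> A \<Longrightarrow> (\<forall>x\<in>U. \<omega> x) \<and> \<theta> powr s \<le> \<theta> powr card {x \<in> L. \<omega> x}"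
  shows "measure_pmf.prob (site_pmf V p) A \<le>
    p ^ card U * (exp ((\<theta> - 1) * p * card L) * \<theta> powr (- s))"
proof -
  let ?P = "site_pmf V p"
  let ?g = "\<lambda>\<omega>. of_bool (\<forall>x\<in>U. \<omega> x) * \<theta> ^ card {x \<in> L. \<omega> x}"
  have int: "integrable (measure_pmf ?P) h" for h :: "_ \<Rightarrow> real"
    using finite_set_pmf_site[OF V] by (rule integrable_measure_pmf_finite)
  have "measure_pmf.prob ?P A = measure_pmf.expectation ?P (indicator A)" by simp
  also have "\<dots> \<le> measure_pmf.expectation ?P (\<lambda>\<omega>. ?g \<omega> * \<theta> powr (- s))"
  proof (rule integral_mono[OF int int])
    fix \<omega>
    show "indicator A \<omega> \<le> ?g \<omega> * \<theta> powr (- s)"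
      using A[of \<omega>] th by (cases "\<omega> \<in> A") (auto simp: powr_minus powr_realpow field_simps)
  qed
  also have "\<dots> = p ^ card U * (1 - p + p * \<theta>) ^ card L * \<theta> powr (- s)"
    using expectation_occupied[OF V p less_imp_le[OF th] UL] by simp
  also have "\<dots> \<le> p ^ card U * exp ((\<theta> - 1) * p * card L) * \<theta> powr (- s)"
    using mgf_bound[of p \<theta>] p th by (intro mult_right_mono mult_left_mono) auto
  finally show ?thesis by (simp add: mult_ac)
qed

lemma lower_tail:
  fixes p \<theta> s :: real
  assumes V: "finite V" and p: "0 \<le> p" "p \<le> 1" and th: "0 < \<theta>" "\<theta> \<le> 1"
    and UL: "U \<subseteq> V" "L \<subseteq> V" "U \<inter> L = {}"
  shows "measure_pmf.prob (site_pmf V p) {\<omega>. (\<forall>x\<in>U. \<omega> x) \<and> card {x \<in> L. \<omega> x} < s} \<le>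
    p ^ card U * (exp ((\<theta> - 1) * p * card L) * \<theta> powr (- s))"
  by (rule markov_occupied[OF V p th(1) UL]) (use th in \<open>auto intro: powr_mono'\<close>)

lemma upper_tail:
  fixes p \<theta> s :: real
  assumes V: "finite V" and p: "0 \<le> p" "p \<le> 1" and th: "1 \<le> \<theta>" and L: "L \<subseteq> V"
  shows "measure_pmf.prob (site_pmf V p) {\<omega>. s \<le> card {x \<in> L. \<omega> x}} \<le>
    exp ((\<theta> - 1) * p * card L) * \<theta> powr (- s)"
  using markov_occupied[of V p \<theta> "{}" L "{\<omega>. s \<le> card {x \<in> L. \<omega> x}}" s] assms
  by (auto intro: powr_mono)

text \<open>
  The set \<open>F \<omega>\<close> is random, but independent of the occupation of \<open>L\<close>.
\<close>

lemma upper_tail_independent: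
  fixes p \<theta> s b :: real
  assumes V: "finite V" and p: "0 \<le> p" "p \<le> 1" and th: "1 \<le> \<theta>" and L: "L \<subseteq> V"
    and F: "\<And>\<omega>. F \<omega> \<subseteq> L" "\<And>\<omega>. card (F \<omega>) \<le> b"
    and indep: "\<And>\<omega> \<omega>'. (\<And>x. x \<in> V - L \<Longrightarrow> \<omega> x = \<omega>' x) \<Longrightarrow> F \<omega> = F \<omega>'"
  shows "measure_pmf.prob (site_pmf V p) {\<omega>. s \<le> card {x \<in> F \<omega>. \<omega> x}} \<le>
    exp ((\<theta> - 1) * p * b) * \<theta> powr (- s)" (is "_ \<le> ?b")
proof -
  let ?P = "site_pmf L p" and ?Q = "site_pmf (V - L) p"
  let ?c = "\<lambda>f g x. if x \<in> V - L then f x else g x"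
  let ?A = "{\<omega>. s \<le> card {x \<in> F \<omega>. \<omega> x}}"
  have finL: "finite L" using L V by (rule finite_subset)
  \<comment> \<open>The configuration is drawn off \<open>L\<close> first. Given that part
    \<open>f\<close>, the set \<open>F\<close> is fixed and the upper tail on \<open>L\<close>
    applies.\<close>
  have "site_pmf V p = site_pmf ((V - L) \<union> L) p" using L by (simp add: Un_absorb2)
  also have "\<dots> = map_pmf (\<lambda>(f, g). ?c f g) (pair_pmf ?Q ?P)"
    using V finL by (subst Pi_pmf_union) (auto simp: case_prod_beta')
  also have "\<dots> = bind_pmf ?Q (\<lambda>f. map_pmf (?c f) ?P)"
    by (simp add: pair_pmf_def map_bind_pmf map_pmf_def bind_assoc_pmf bind_return_pmf)
  finally have eq: "site_pmf V p = bind_pmf ?Q (\<lambda>f. map_pmf (?c f) ?P)" .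
  have le: "measure_pmf.prob (map_pmf (?c f) ?P) ?A \<le> ?b" for f
  proof -
    have F': "F (?c f g) = F f" for g by (rule indep) auto
    have "{x \<in> F (?c f g). ?c f g x} = {x \<in> F f. g x}" for g unfolding F' using F(1)[of f] by auto
    then have "measure_pmf.prob (map_pmf (?c f) ?P) ?A = measure_pmf.prob ?P {g. s \<le> card {x \<in> F f. g x}}"
      by (simp add: vimage_def)
    also have "\<dots> \<le> exp ((\<theta> - 1) * p * card (F f)) * \<theta> powr (- s)"
      by (rule upper_tail[OF finL p th F(1)])
    also have "\<dots> \<le> ?b"
      using F(2)[of f] p th by (intro mult_right_mono) (auto intro!: mult_left_mono)
    finally show ?thesis .
  qed
  have b0: "0 \<le> ?b" by simp
  have "emeasure (site_pmf V p) ?A \<le> (\<integral>\<^sup>+f. ennreal ?b \<partial>?Q)"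
    unfolding eq emeasure_bind_pmf
    by (intro nn_integral_mono) (simp only: measure_pmf.emeasure_eq_measure ennreal_leI[OF le])
  then show ?thesis using b0 by (simp add: measure_pmf.emeasure_eq_measure)
qed

lemma prob_union_bound:
  fixes b :: real
  assumes "finite J" "\<And>j. j \<in> J \<Longrightarrow> measure_pmf.prob P {\<omega>. Q j \<omega>} \<le> b"
  shows "measure_pmf.prob P {\<omega>. \<exists>j\<in>J. Q j \<omega>} \<le> card J * b"
proof -
  have "{\<omega>. \<exists>j\<in>J. Q j \<omega>} = (\<Union>j\<in>J. {\<omega>. Q j \<omega>})" by auto
  then have "measure_pmf.prob P {\<omega>. \<exists>j\<in>J. Q j \<omega>} \<le> (\<Sum>j\<in>J. measure_pmf.prob P {\<omega>. Q j \<omega>})"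
    using assms(1) by (simp add: measure_pmf.finite_measure_subadditive_finite)
  also have "\<dots> \<le> card J * b" using sum_bounded_above[of J "\<lambda>j. measure_pmf.prob P {\<omega>. Q j \<omega>}" b] assms(2) by simp
  finally show ?thesis .
qed

section \<open>Components of the site subgraph\<close>

lemma dominates_site_subgraph:
  "x \<rightarrow>\<^bsub>site_subgraph d a n \<omega>\<^esub> y \<longleftrightarrow>
     x \<in> {x \<in> hamming_torus_verts d a n. \<omega> x} \<and> y \<in> {x \<in> hamming_torus_verts d a n. \<omega> x} \<and>
     card {i \<in> {1..d}. x i \<noteq> y i} = 1"
  by (auto simp: arcs_ends_def arc_to_ends_def site_subgraph_def hamming_torus_def with_proj_def image_iff)

lemma sym_digraph_site_subgraph: "sym_digraph (site_subgraph d a n \<omega>)"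
proof -
  interpret pair_graph "hamming_torus d a n" by (rule pair_graph_hamming_torus)
  have "wf_digraph (site_subgraph d a n \<omega>)"
    unfolding site_subgraph_def by (rule wellformed_induce_subgraph)
  moreover have "symmetric (site_subgraph d a n \<omega>)"
    unfolding symmetric_def by (intro symI) (simp add: dominates_site_subgraph eq_commute[of "_ _" "_ _"])
  ultimately show ?thesis by (simp add: sym_digraph_def sym_digraph_axioms_def)
qed

lemma verts_site_subgraph: "verts (site_subgraph d a n \<omega>) = {x \<in> hamming_torus_verts d a n. \<omega> x}"
  by (simp add: site_subgraph_def)

text \<open>The component of \<open>w\<close> contains \<open>w'\<close> as well, while every other
  component consists of a single isolated vertex; hence it is strictly the largest.\<close>

lemma giant_component_exists:
  fixes G :: "('v, 'e) pre_digraph"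
  assumes "sym_digraph G" and fin: "finite (verts G)"
    and w: "w' \<in> verts G" "w \<noteq> w'" "w \<rightarrow>\<^sup>*\<^bsub>G\<^esub> w'"
    and reach: "\<And>v. v \<in> verts G \<Longrightarrow> isolated_vertex G v \<or> w \<rightarrow>\<^sup>*\<^bsub>G\<^esub> v"
  shows "\<exists>C. is_giant_component G C \<and> (\<forall>v\<in>verts G. isolated_vertex G v \<or> v \<in> C)"
proof -
  interpret sym_digraph G by fact
  let ?C = "scc_of w"
  have wG: "w \<in> verts G" using w(3) by (rule reachable_in_verts)
  have inC: "v \<in> ?C \<longleftrightarrow> w \<rightarrow>\<^sup>*\<^bsub>G\<^esub> v" for v
    using symmetric_reachable[OF sym_arcs] by (auto simp: scc_of_def)
  have C: "?C \<in> sccs_verts" using wG by (rule scc_of_in_sccs_verts)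
  have "card S < card ?C" if S: "S \<in> sccs_verts" "S \<noteq> ?C" for S
  proof -
    obtain v where v: "v \<in> verts G" "S = scc_of v"
      using S(1) unfolding sccs_verts_conv_scc_of by blast
    have "\<not> w \<rightarrow>\<^sup>*\<^bsub>G\<^esub> v"
    proof
      assume "w \<rightarrow>\<^sup>*\<^bsub>G\<^esub> v"
      then have "v \<in> S \<inter> ?C" using v inC in_scc_of_self by auto
      then show False using sccs_verts_disjoint[OF S(1) C S(2)] by auto
    qed
    then have iso: "isolated_vertex G v" using reach v by blast
    have "u = v" if "v \<rightarrow>\<^sup>*\<^bsub>G\<^esub> u" for u
      using that iso by (cases rule: converse_reachable_cases) (auto simp: isolated_vertex_def)
    then have "S \<subseteq> {v}" using v by (auto simp: scc_of_def)
    then have "card S \<le> 1" using card_mono[of "{v}" S] by simp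
    also have "1 < card {w, w'}" using w by simp
    also have "\<dots> \<le> card ?C"
      using w wG inC sccs_verts_subsets[OF C] fin by (intro card_mono) (auto intro: finite_subset)
    finally show ?thesis .
  qed
  then have "is_giant_component G ?C" using C by (auto simp: is_giant_component_def)
  then show ?thesis using reach inC by blast
qed

lemma differ_in_one_coordinate:
  assumes "x \<in> PiE D I" "y \<in> PiE D I" "card {i \<in> D. x i \<noteq> y i} = 1"
  obtains k where "k \<in> D" "y k \<noteq> x k" "y = x(k := y k)"
proof -
  obtain k where k: "{i \<in> D. x i \<noteq> y i} = {k}" using assms(3) card_1_singletonE by blast
  have "y i = (x(k := y k)) i" for i
    using k assms(1,2) by (cases "i \<in> D") (auto simp: PiE_def extensional_def)
  then have "y = x(k := y k)" by blast
  moreover have "k \<in> {i \<in> D. x i \<noteq> y i}" unfolding k by simp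
  ultimately show thesis using that by fastforce
qed

section \<open>Probabilities of the exceptional events\<close>

lemma card_image_Collect: "inj_on f J \<Longrightarrow> card {x \<in> f ` J. Q x} = card {j \<in> J. Q (f j)}"
proof -
  assume f: "inj_on f J"
  have "{x \<in> f ` J. Q x} = f ` {j \<in> J. Q (f j)}" by auto
  then show ?thesis using f by (simp add: card_image inj_on_subset)
qed

lemma vacant_rectangleE:
  assumes "\<not> no_vacant_rectangle I e X i j y"
  obtains S T where "S \<subseteq> I i" "T \<subseteq> I j" "e * card (I i) \<le> card S" "e * card (I j) \<le> card T"
    "\<And>s t. s \<in> S \<Longrightarrow> t \<in> T \<Longrightarrow> y(i := s, j := t) \<notin> X"
  using assms unfolding no_vacant_rectangle_def by blast

lemma inj_on_fun_upd: "inj_on (\<lambda>s. x(i := s)) S"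
  by (rule inj_onI) (metis fun_upd_same)

lemma inj_on_fun_upd2: "i \<noteq> j \<Longrightarrow> inj_on (\<lambda>(s, t). y(i := s, j := t)) S"
proof (rule inj_onI)
  fix q q' assume ij: "i \<noteq> j" and eq: "(\<lambda>(s, t). y(i := s, j := t)) q = (\<lambda>(s, t). y(i := s, j := t)) q'"
  show "q = q'"
    using fun_cong[OF eq, of i] fun_cong[OF eq, of j] ij by (cases q; cases q') simp
qed

text \<open>Each end contributes its lines in directions other than \<open>k\<close>, whereas the
  line in direction \<open>k\<close> is shared and counted once. This loss of
  \<open>card (I k)\<close> is where the denominator in the bound on \<open>c\<close> comes
  from.\<close>

lemma card_edge_nbhd:
  assumes D: "finite D" and I: "\<And>i. i \<in> D \<Longrightarrow> finite (I i)" and v: "v \<in> PiE D I"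
    and k: "k \<in> D" and s: "s \<in> I k" "s \<noteq> v k"
  shows "2 * (\<Sum>i\<in>D. real (card (I i))) - card (I k) - 2 * card D \<le> card (edge_nbhd D I v (v(k := s)))"
proof -
  let ?u = "v(k := s)"
  let ?J = "SIGMA i:D - {k}. I i - {v i}"
  let ?f = "\<lambda>w (i, s). w(i := s)"
  let ?P = "?f v ` ?J" and ?Q = "?f ?u ` ?J" and ?R = "(\<lambda>t. v(k := t)) ` (I k - {v k, s})"
  have vI: "v i \<in> I i" if "i \<in> D" for i using v that by (rule PiE_mem)
  have finJ: "finite ?J" using D I by auto
  \<comment> \<open>Since the new value differs from \<open>v i\<close>, the changed coordinate can
    be read off the result.\<close>
  have inj: "inj_on (?f w) ?J" if w: "\<And>i. i \<noteq> k \<Longrightarrow> w i = v i" for w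
  proof (rule inj_onI)
    fix q q' assume q: "q \<in> ?J" "q' \<in> ?J" and "?f w q = ?f w q'"
    obtain i a i' b where qq: "q = (i, a)" "q' = (i', b)" by (cases q; cases q')
    with q have ne: "i \<noteq> k" "i' \<noteq> k" "a \<noteq> v i" "b \<noteq> v i'" by auto
    have eq: "w(i := a) = w(i' := b)" using \<open>?f w q = ?f w q'\<close> qq by simp
    have "i = i'" using fun_cong[OF eq, of i] ne w by (cases "i = i'") auto
    moreover have "a = b" using fun_cong[OF eq, of i] calculation by simp
    ultimately show "q = q'" using qq by simp
  qed
  have cP: "card ?P = card ?J" by (rule card_image[OF inj]) simp
  have cQ: "card ?Q = card ?J" by (rule card_image[OF inj]) simp
  have cR: "card ?R = card (I k) - 2"
    using I[OF k] s vI[OF k] by (simp add: card_image inj_on_fun_upd card_Diff_subset)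
  \<comment> \<open>The three parts are told apart by their coordinate \<open>k\<close>.\<close>
  have valP: "z k = v k" if "z \<in> ?P" for z using that by auto
  have valQ: "z k = s" if "z \<in> ?Q" for z using that by auto
  have valR: "z k \<noteq> v k \<and> z k \<noteq> s" if "z \<in> ?R" for z using that by auto
  have fin: "finite ?P" "finite ?Q" "finite ?R" using finJ I[OF k] by auto
  have eq: "card (?P \<union> ?Q \<union> ?R) = card ?P + card ?Q + card ?R"
  proof -
    have "?P \<inter> ?Q = {}" using valP valQ s(2) by blast
    moreover have "(?P \<union> ?Q) \<inter> ?R = {}" using valP valQ valR by blast
    ultimately show ?thesis using fin by (simp only: card_Un_disjoint finite_UnI)
  qed
  have sub: "?P \<union> ?Q \<union> ?R \<subseteq> edge_nbhd D I v ?u"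
  proof -
    have "z \<in> edge_nbhd D I v ?u" if "z \<in> ?P" for z
    proof -
      obtain i a where z: "i \<in> D" "i \<noteq> k" "a \<in> I i" "a \<noteq> v i" "z = v(i := a)" using \<open>z \<in> ?P\<close> by auto
      then have "z i \<noteq> v i" "z k \<noteq> ?u k" using s(2) by auto
      then have "z \<noteq> v" "z \<noteq> ?u" by auto
      then show ?thesis using z by (auto simp: edge_nbhd_def)
    qed
    moreover have "z \<in> edge_nbhd D I v ?u" if "z \<in> ?Q" for z
    proof -
      obtain i a where z: "i \<in> D" "i \<noteq> k" "a \<in> I i" "a \<noteq> v i" "z = ?u(i := a)" using \<open>z \<in> ?Q\<close> by auto
      then have "z k \<noteq> v k" "z i \<noteq> ?u i" using s(2) by auto
      then have "z \<noteq> v" "z \<noteq> ?u" by auto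
      then show ?thesis using z by (auto simp: edge_nbhd_def)
    qed
    moreover have "z \<in> edge_nbhd D I v ?u" if "z \<in> ?R" for z
    proof -
      obtain a where z: "a \<in> I k" "a \<noteq> v k" "a \<noteq> s" "z = v(k := a)" using \<open>z \<in> ?R\<close> by auto
      then have "z k \<noteq> v k" "z k \<noteq> ?u k" by auto
      then have "z \<noteq> v" "z \<noteq> ?u" by auto
      then show ?thesis using z k by (auto simp: edge_nbhd_def)
    qed
    ultimately show ?thesis by blast
  qed
  have "finite (edge_nbhd D I v ?u)" using D I by (auto simp: edge_nbhd_def)
  from card_mono[OF this sub] have le: "card ?P + card ?Q + card ?R \<le> card (edge_nbhd D I v ?u)"
    by (simp only: eq)
  have "real (card ?J) = (\<Sum>i\<in>D - {k}. real (card (I i)) - 1)"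
  proof -
    have "card ?J = (\<Sum>i\<in>D - {k}. card (I i - {v i}))" using D I by (subst card_SigmaI) auto
    also have "real \<dots> = (\<Sum>i\<in>D - {k}. real (card (I i)) - 1)"
      unfolding of_nat_sum
    proof (rule sum.cong)
      fix i assume i: "i \<in> D - {k}"
      then have "0 < card (I i)" using vI[of i] I[of i] by (auto simp: card_gt_0_iff)
      then show "real (card (I i - {v i})) = real (card (I i)) - 1"
        using i vI[of i] I[of i] by (simp add: card_Diff_singleton of_nat_diff)
    qed simp
    finally show ?thesis .
  qed
  also have "\<dots> = (\<Sum>i\<in>D. real (card (I i)) - 1) - (real (card (I k)) - 1)"
    using D k by (simp add: sum_diff1)
  finally have cJ: "real (card ?J) = (\<Sum>i\<in>D. real (card (I i))) - card D - card (I k) + 1"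
    by (simp add: sum_subtractf)
  have "real (card (I k)) - 2 \<le> card ?R" unfolding cR by linarith
  then show ?thesis using le cJ unfolding cP cQ by linarith
qed

section \<open>Bounds for the single exceptional events and their union\<close>

locale percolation_grid =
  fixes D :: "'i set" and I :: "'i \<Rightarrow> 'b set" and p :: real
  assumes finite_D: "finite D" and finite_I: "\<And>i. i \<in> D \<Longrightarrow> finite (I i)"
    and I_ne: "\<And>i. i \<in> D \<Longrightarrow> I i \<noteq> {}" and p: "0 \<le> p" "p \<le> 1"
begin

abbreviation "V \<equiv> PiE D I"
abbreviation "Occ \<omega> \<equiv> {x \<in> V. \<omega> x}"
abbreviation "P \<equiv> site_pmf V p"

lemma finite_V: "finite V"
  using finite_D finite_I by (intro finite_PiE) auto

lemma upd_V: "x \<in> V \<Longrightarrow> i \<in> D \<Longrightarrow> s \<in> I i \<Longrightarrow> x(i := s) \<in> V"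
  by (auto simp: PiE_def extensional_def)

text \<open>The lower tail at \<theta> = 1/2. The parametrisation \<open>f\<close> allows one bound
  to serve for lines, families of lines and rectangles.\<close>

lemma prob_few_on_image:
  assumes f: "inj_on f J" "f ` J \<subseteq> V" and J: "finite J"
  shows "measure_pmf.prob P {\<omega>. real (card {j \<in> J. f j \<in> Occ \<omega>}) < m} \<le> exp (- (p * card J) / 2) * 2 powr m"
proof -
  have "{j \<in> J. \<omega> (f j)} = {j \<in> J. f j \<in> Occ \<omega>}" for \<omega> using f(2) by blast
  then have "card {x \<in> f ` J. \<omega> x} = card {j \<in> J. f j \<in> Occ \<omega>}" for \<omega>
    by (simp only: card_image_Collect[OF f(1)])
  then have "measure_pmf.prob P {\<omega>. real (card {j \<in> J. f j \<in> Occ \<omega>}) < m} \<le>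
      p ^ card ({} :: ('i \<Rightarrow> 'b) set) * (exp ((1/2 - 1) * p * card (f ` J)) * (1/2) powr (- m))"
    using lower_tail[OF finite_V p, of "1/2" "{}" "f ` J" m] f(2) by simp
  also have "\<dots> = exp (- (p * card J) / 2) * 2 powr m"
    using f(1) by (simp add: card_image powr_minus powr_divide inverse_eq_divide)
  finally show ?thesis .
qed

lemma prob_not_rich:
  assumes "i \<in> D" "x \<in> V"
  shows "measure_pmf.prob P {\<omega>. \<not> rich I m (Occ \<omega>) i x} \<le> exp (- (p * card (I i)) / 2) * 2 powr m"
  unfolding rich_def not_le
  by (rule prob_few_on_image[OF inj_on_fun_upd]) (use assms finite_I upd_V in auto)

text \<open>
  A failure picks for every \<open>t\<close> one of the two lines that is not rich; there are \<open>2 ^ card (I j)\<close>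
  choices, and for each of them the chosen lines are disjoint.
\<close>

lemma prob_no_rich_pair:
  assumes ij: "i \<in> D" "j \<in> D" "i \<noteq> j" and xy: "x \<in> V" "y \<in> V"
  shows "measure_pmf.prob P {\<omega>. \<not> (\<exists>t\<in>I j. rich I m (Occ \<omega>) i (x(j := t)) \<and> rich I m (Occ \<omega>) i (y(j := t)))} \<le>
    2 ^ card (I j) * (exp (- (p * (card (I i) * card (I j))) / 2) * 2 powr (m * card (I j)))"
proof -
  let ?F = "PiE (I j) (\<lambda>_. {x, y})"
  let ?f = "\<lambda>\<sigma> (t, s). (\<sigma> t)(j := t, i := s)"
  let ?J = "I j \<times> I i"
  let ?N = "\<lambda>\<omega> \<sigma>. real (card {q \<in> ?J. ?f \<sigma> q \<in> Occ \<omega>})"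
  have finF: "finite ?F" using finite_I ij by (intro finite_PiE) auto
  have "{\<omega>. \<not> (\<exists>t\<in>I j. rich I m (Occ \<omega>) i (x(j := t)) \<and> rich I m (Occ \<omega>) i (y(j := t)))}
      \<subseteq> {\<omega>. \<exists>\<sigma>\<in>?F. ?N \<omega> \<sigma> < m * card (I j)}"
  proof (intro subsetI CollectI)
    fix \<omega>
    assume "\<omega> \<in> {\<omega>. \<not> (\<exists>t\<in>I j. rich I m (Occ \<omega>) i (x(j := t)) \<and> rich I m (Occ \<omega>) i (y(j := t)))}"
    then have bad: "\<not> rich I m (Occ \<omega>) i (x(j := t)) \<or> \<not> rich I m (Occ \<omega>) i (y(j := t))" if "t \<in> I j" for t
      using that by auto
    define \<sigma> where "\<sigma> = (\<lambda>t\<in>I j. if rich I m (Occ \<omega>) i (x(j := t)) then y else x)"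
    have \<sigma>: "\<sigma> \<in> ?F" by (auto simp: \<sigma>_def)
    have nr: "real (card {s \<in> I i. (\<sigma> t)(j := t, i := s) \<in> Occ \<omega>}) < m" if "t \<in> I j" for t
    proof -
      have "\<not> rich I m (Occ \<omega>) i ((\<sigma> t)(j := t))" using bad[OF that] that by (auto simp: \<sigma>_def)
      then show ?thesis by (simp add: rich_def)
    qed
    have "{q \<in> ?J. ?f \<sigma> q \<in> Occ \<omega>} = (SIGMA t:I j. {s \<in> I i. (\<sigma> t)(j := t, i := s) \<in> Occ \<omega>})" by auto
    then have "?N \<omega> \<sigma> = (\<Sum>t\<in>I j. real (card {s \<in> I i. (\<sigma> t)(j := t, i := s) \<in> Occ \<omega>}))"
      using finite_I ij by (simp add: card_SigmaI)
    also have "\<dots> < (\<Sum>t\<in>I j. m)"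
      using nr finite_I I_ne ij by (intro sum_strict_mono) auto
    finally show "\<exists>\<sigma>\<in>?F. ?N \<omega> \<sigma> < m * card (I j)" using \<sigma> by (intro bexI[of _ \<sigma>]) (auto simp: mult.commute)
  qed
  then have "measure_pmf.prob P {\<omega>. \<not> (\<exists>t\<in>I j. rich I m (Occ \<omega>) i (x(j := t)) \<and> rich I m (Occ \<omega>) i (y(j := t)))}
      \<le> measure_pmf.prob P {\<omega>. \<exists>\<sigma>\<in>?F. ?N \<omega> \<sigma> < m * card (I j)}"
    by (intro measure_pmf.finite_measure_mono) auto
  also have "\<dots> \<le> card ?F * (exp (- (p * card ?J) / 2) * 2 powr (m * card (I j)))"
  proof (rule prob_union_bound[OF finF], rule prob_few_on_image)
    fix \<sigma> assume \<sigma>: "\<sigma> \<in> ?F"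
    \<comment> \<open>Coordinates \<open>j\<close> and \<open>i\<close> of the image return
      \<open>t\<close> and \<open>s\<close>, whatever the choice \<sigma> was.\<close>
    show "inj_on (?f \<sigma>) ?J"
    proof (rule inj_onI)
      fix q q' assume eq: "?f \<sigma> q = ?f \<sigma> q'"
      show "q = q'"
        using fun_cong[OF eq, of i] fun_cong[OF eq, of j] ij by (cases q; cases q') simp
    qed
    have "\<sigma> t \<in> V" if "t \<in> I j" for t using PiE_mem[OF \<sigma> that] xy by auto
    then have "?f \<sigma> q \<in> V" if "q \<in> ?J" for q
      using upd_V[OF upd_V[OF _ ij(2)] ij(1)] that by (cases q) simp
    then show "?f \<sigma> ` ?J \<subseteq> V" by blast
  qed (use finite_I ij in auto)
  also have "\<dots> \<le> 2 ^ card (I j) * (exp (- (p * (card (I i) * card (I j))) / 2) * 2 powr (m * card (I j)))"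
  proof (rule mult_mono)
    have "card ?F = card {x, y} ^ card (I j)" using finite_I ij by (simp add: card_PiE)
    also have "\<dots> \<le> 2 ^ card (I j)" by (intro power_mono) (auto simp: card_insert_if)
    finally show "real (card ?F) \<le> 2 ^ card (I j)" by (simp add: numeral_power_le_of_nat_cancel_iff of_nat_le_numeral_power_cancel_iff)
  qed (auto simp: card_cartesian_product mult_ac)
  finally show ?thesis .
qed

text \<open>Union bound over all pairs of subsets of the two sides. Vacancy is written as a count
  below 1, which gives the final factor \<open>2 powr 1\<close>.\<close>

lemma prob_vacant_rectangle:
  assumes ij: "i \<in> D" "j \<in> D" "i \<noteq> j" and y: "y \<in> V" and e: "0 \<le> e"
  shows "measure_pmf.prob P {\<omega>. \<not> no_vacant_rectangle I e (Occ \<omega>) i j y} \<le>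
    2 ^ (card (I i) + card (I j)) * (exp (- (p * (e\<^sup>2 * (card (I i) * card (I j)))) / 2) * 2)"
proof -
  let ?F = "{Z \<in> Pow (I i) \<times> Pow (I j). e * card (I i) \<le> card (fst Z) \<and> e * card (I j) \<le> card (snd Z)}"
  let ?f = "\<lambda>(s, t). y(i := s, j := t)"
  let ?N = "\<lambda>\<omega> Z. real (card {q \<in> fst Z \<times> snd Z. ?f q \<in> Occ \<omega>})"
  have fin: "finite (I i)" "finite (I j)" using finite_I ij by auto
  have subF: "?F \<subseteq> Pow (I i) \<times> Pow (I j)" by (rule Collect_subset)
  have finP: "finite (Pow (I i) \<times> Pow (I j))" using fin by (intro finite_cartesian_product) simp_all
  have finF: "finite ?F" using subF finP by (rule finite_subset)
  have "{\<omega>. \<not> no_vacant_rectangle I e (Occ \<omega>) i j y} \<subseteq> {\<omega>. \<exists>Z\<in>?F. ?N \<omega> Z < 1}"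
  proof (intro subsetI CollectI)
    fix \<omega> assume "\<omega> \<in> {\<omega>. \<not> no_vacant_rectangle I e (Occ \<omega>) i j y}"
    then have "\<not> no_vacant_rectangle I e (Occ \<omega>) i j y" by simp
    then obtain S T where ST: "S \<subseteq> I i" "T \<subseteq> I j" "e * card (I i) \<le> card S" "e * card (I j) \<le> card T"
        "\<And>s t. s \<in> S \<Longrightarrow> t \<in> T \<Longrightarrow> y(i := s, j := t) \<notin> Occ \<omega>"
      by (rule vacant_rectangleE) blast
    have "{q \<in> S \<times> T. ?f q \<in> Occ \<omega>} = {}" using ST(5) by auto
    then have "?N \<omega> (S, T) < 1" by (simp only: fst_conv snd_conv card.empty)
    then show "\<exists>Z\<in>?F. ?N \<omega> Z < 1" using ST by (intro bexI[of _ "(S, T)"]) auto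
  qed
  then have "measure_pmf.prob P {\<omega>. \<not> no_vacant_rectangle I e (Occ \<omega>) i j y} \<le>
      measure_pmf.prob P {\<omega>. \<exists>Z\<in>?F. ?N \<omega> Z < 1}"
    by (intro measure_pmf.finite_measure_mono) auto
  also have "\<dots> \<le> card ?F * (exp (- (p * (e\<^sup>2 * (card (I i) * card (I j)))) / 2) * 2)"
  proof (rule prob_union_bound[OF finF])
    fix Z assume "Z \<in> ?F"
    then obtain S T where Z: "Z = (S, T)" "S \<subseteq> I i" "T \<subseteq> I j" "e * card (I i) \<le> card S" "e * card (I j) \<le> card T"
      by auto
    have "(e * card (I i)) * (e * card (I j)) \<le> real (card S) * real (card T)"
      using Z e by (intro mult_mono) auto
    then have c: "e\<^sup>2 * (card (I i) * card (I j)) \<le> card (S \<times> T)"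
      by (simp add: card_cartesian_product power2_eq_square mult_ac)
    have "measure_pmf.prob P {\<omega>. ?N \<omega> Z < 1} \<le> exp (- (p * card (S \<times> T)) / 2) * 2 powr 1"
      unfolding Z(1) fst_conv snd_conv
    proof (rule prob_few_on_image[OF inj_on_fun_upd2[OF ij(3)]])
      show "?f ` (S \<times> T) \<subseteq> V" using Z upd_V y ij by auto
      show "finite (S \<times> T)" using Z fin by (auto intro: finite_subset)
    qed
    also have "\<dots> \<le> exp (- (p * (e\<^sup>2 * (card (I i) * card (I j)))) / 2) * 2"
      using mult_left_mono[OF c p(1)] by simp
    finally show "measure_pmf.prob P {\<omega>. ?N \<omega> Z < 1} \<le> \<dots>" .
  qed
  also have "\<dots> \<le> 2 ^ (card (I i) + card (I j)) * (exp (- (p * (e\<^sup>2 * (card (I i) * card (I j)))) / 2) * 2)"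
  proof (rule mult_right_mono)
    have "card ?F \<le> card (Pow (I i) \<times> Pow (I j))" by (rule card_mono[OF finP subF])
    also have "\<dots> = 2 ^ (card (I i) + card (I j))"
      using fin by (simp add: card_cartesian_product card_Pow power_add)
    finally show "real (card ?F) \<le> 2 ^ (card (I i) + card (I j))"
      by (simp add: of_nat_le_numeral_power_cancel_iff)
  qed simp
  finally show ?thesis .
qed

text \<open>The line \<open>?L\<close> is what \<open>max_small_union\<close> does not inspect. So
  the exceptional sites on it, at most a proportion \<open>e\<close>, are chosen independently of
  its occupation, and a large \<theta> makes many occupied ones unlikely.\<close>

lemma prob_many_exceptions:
  fixes \<theta> e m :: real
  assumes ij: "i \<in> D" "j \<in> D" "i \<noteq> j" and y: "y \<in> V" and e: "0 < e" and th: "1 \<le> \<theta>"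
  shows "measure_pmf.prob P {\<omega>. \<not> card {s \<in> fst (max_small_union I e (Occ \<omega>) i j y). y(i := s) \<in> Occ \<omega>} < m} \<le>
    exp ((\<theta> - 1) * p * (e * card (I i))) * \<theta> powr (- m)"
proof -
  let ?L = "(\<lambda>s. y(i := s)) ` I i"
  let ?S = "\<lambda>\<omega>. fst (max_small_union I e (Occ \<omega>) i j y)"
  let ?F = "\<lambda>\<omega>. (\<lambda>s. y(i := s)) ` ?S \<omega>"
  have su: "small_union I e (Occ \<omega>) i j y (max_small_union I e (Occ \<omega>) i j y)" for \<omega>
    using finite_I I_ne ij e by (intro max_small_union(1)) auto
  then have sub: "?S \<omega> \<subseteq> I i" and c: "real (card (?S \<omega>)) \<le> e * card (I i)" for \<omega>
    by (auto simp: small_union_def case_prod_beta' less_imp_le)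
  have L: "?L \<subseteq> V" using upd_V y ij by auto
  have "card {x \<in> ?F \<omega>. \<omega> x} = card {s \<in> ?S \<omega>. y(i := s) \<in> Occ \<omega>}" for \<omega>
  proof -
    have "{x \<in> ?F \<omega>. \<omega> x} = {x \<in> ?F \<omega>. x \<in> Occ \<omega>}" using L sub[of \<omega>] by blast
    then show ?thesis using card_image_Collect[OF inj_on_fun_upd, of y i "?S \<omega>" "\<lambda>x. x \<in> Occ \<omega>"] by simp
  qed
  moreover have "measure_pmf.prob P {\<omega>. m \<le> card {x \<in> ?F \<omega>. \<omega> x}} \<le>
      exp ((\<theta> - 1) * p * (e * card (I i))) * \<theta> powr (- m)"
  proof (rule upper_tail_independent[OF finite_V p th L])
    fix \<omega> \<omega>' :: "('i \<Rightarrow> 'b) \<Rightarrow> bool" assume eq: "\<And>x. x \<in> V - ?L \<Longrightarrow> \<omega> x = \<omega>' x"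
    have "max_small_union I e (Occ \<omega>) i j y = max_small_union I e (Occ \<omega>') i j y"
    proof (rule max_small_union_cong)
      fix s t assume st: "s \<in> I i" "t \<in> I j" "t \<noteq> y j"
      have "y(i := s, j := t) \<notin> ?L"
      proof
        assume "y(i := s, j := t) \<in> ?L"
        then obtain s' where "y(i := s, j := t) = y(i := s')" by auto
        from fun_cong[OF this, of j] show False using st ij by simp
      qed
      then show "y(i := s, j := t) \<in> Occ \<omega> \<longleftrightarrow> y(i := s, j := t) \<in> Occ \<omega>'" using eq by auto
    qed
    then show "?F \<omega> = ?F \<omega>'" by simp
  qed (use sub c in \<open>auto simp: card_image[OF inj_on_fun_upd]\<close>)
  ultimately show ?thesis by (simp add: not_less)
qed

text \<open>The factor \<open>p\<^sup>2\<close> is the probability that both ends are occupied. It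
  reduces the order \<open>n ^ (d + 1)\<close> of the number of edges to \<open>n ^ (d - 1)\<close>
  up to logarithms, whence the numerator \<open>d - 1\<close> in the bound on
  \<open>c\<close>.\<close>

lemma prob_sparse_edge:
  fixes \<theta> b M :: real
  assumes k: "k \<in> D" "v \<in> V" "s \<in> I k" "s \<noteq> v k" and th: "0 < \<theta>" "\<theta> \<le> 1"
    and M: "M \<le> card (edge_nbhd D I v (v(k := s)))"
  shows "measure_pmf.prob P {\<omega>. v \<in> Occ \<omega> \<and> v(k := s) \<in> Occ \<omega> \<and>
      card {x \<in> edge_nbhd D I v (v(k := s)). x \<in> Occ \<omega>} < b} \<le> p\<^sup>2 * (exp ((\<theta> - 1) * p * M) * \<theta> powr (- b))"
proof -
  let ?U = "{v, v(k := s)}" and ?L = "edge_nbhd D I v (v(k := s))"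
  have U: "?U \<subseteq> V" using k upd_V by auto
  have L: "?L \<subseteq> V" using k upd_V by (auto simp: edge_nbhd_def intro!: upd_V)
  have "v \<noteq> v(k := s)" using k(4) by (metis fun_upd_same)
  then have cU: "card ?U = 2" by simp
  have "{\<omega>. v \<in> Occ \<omega> \<and> v(k := s) \<in> Occ \<omega> \<and> card {x \<in> ?L. x \<in> Occ \<omega>} < b} \<subseteq>
      {\<omega>. (\<forall>x\<in>?U. \<omega> x) \<and> card {x \<in> ?L. \<omega> x} < b}"
  proof (intro subsetI CollectI)
    fix \<omega> assume \<omega>: "\<omega> \<in> {\<omega>. v \<in> Occ \<omega> \<and> v(k := s) \<in> Occ \<omega> \<and> card {x \<in> ?L. x \<in> Occ \<omega>} < b}"
    have "{x \<in> ?L. x \<in> Occ \<omega>} = {x \<in> ?L. \<omega> x}" using L by blast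
    then show "(\<forall>x\<in>?U. \<omega> x) \<and> card {x \<in> ?L. \<omega> x} < b" using \<omega> by auto
  qed
  then have "measure_pmf.prob P {\<omega>. v \<in> Occ \<omega> \<and> v(k := s) \<in> Occ \<omega> \<and> card {x \<in> ?L. x \<in> Occ \<omega>} < b} \<le>
      measure_pmf.prob P {\<omega>. (\<forall>x\<in>?U. \<omega> x) \<and> card {x \<in> ?L. \<omega> x} < b}"
    by (intro measure_pmf.finite_measure_mono) auto
  also have "\<dots> \<le> p ^ card ?U * (exp ((\<theta> - 1) * p * card ?L) * \<theta> powr (- b))"
    by (rule lower_tail[OF finite_V p th U L]) (auto simp: edge_nbhd_def)
  also have "\<dots> \<le> p\<^sup>2 * (exp ((\<theta> - 1) * p * M) * \<theta> powr (- b))"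
  proof -
    have "(\<theta> - 1) * p * card ?L \<le> (\<theta> - 1) * p * M"
      using M th p by (intro mult_left_mono_neg) (auto simp: mult_nonpos_nonneg)
    then show ?thesis unfolding cU by (intro mult_left_mono mult_right_mono) auto
  qed
  finally show ?thesis .
qed

text \<open>The first clause supplies a rich line to start from even in dimension one, where the
  clauses about pairs of directions are vacuous.\<close>

definition good_config :: "real \<Rightarrow> real \<Rightarrow> 'i \<Rightarrow> ('i \<Rightarrow> 'b) \<Rightarrow> (('i \<Rightarrow> 'b) \<Rightarrow> bool) \<Rightarrow> bool" where
  "good_config e m i0 x0 \<omega> \<longleftrightarrow> rich I m (Occ \<omega>) i0 x0 \<and>
     (\<forall>k\<in>D. \<forall>v\<in>Occ \<omega>. \<forall>s\<in>I k. s \<noteq> v k \<longrightarrow> v(k := s) \<in> Occ \<omega> \<longrightarrow>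
        2 * real (card D) * m \<le> real (card {x \<in> edge_nbhd D I v (v(k := s)). x \<in> Occ \<omega>})) \<and>
     (\<forall>i\<in>D. \<forall>j\<in>D. i \<noteq> j \<longrightarrow> (\<forall>x\<in>V. \<forall>y\<in>V. \<exists>t\<in>I j.
        rich I m (Occ \<omega>) i (x(j := t)) \<and> rich I m (Occ \<omega>) i (y(j := t)))) \<and>
     (\<forall>i\<in>D. \<forall>j\<in>D. i \<noteq> j \<longrightarrow> (\<forall>y\<in>V. no_vacant_rectangle I e (Occ \<omega>) i j y)) \<and>
     (\<forall>i\<in>D. \<forall>j\<in>D. i \<noteq> j \<longrightarrow> (\<forall>y\<in>V.
        real (card {s \<in> fst (max_small_union I e (Occ \<omega>) i j y). y(i := s) \<in> Occ \<omega>}) < m))"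

text \<open>Union bound over five kinds of failure; the coefficients of \<open>b1\<close> to
  \<open>b5\<close> bound the number of lines, edges, pairs of parallel lines and planes
  considered.\<close>

lemma prob_not_good_config:
  fixes e m \<theta> \<theta>' M A N b1 b2 b3 b4 b5 :: real
  assumes i0: "i0 \<in> D" "x0 \<in> V" and e: "0 < e" and th: "0 < \<theta>" "\<theta> \<le> 1" "1 \<le> \<theta>'"
    and A: "\<And>i. i \<in> D \<Longrightarrow> card (I i) \<le> A" and N: "card V \<le> N"
    and M: "\<And>k. k \<in> D \<Longrightarrow> M \<le> 2 * (\<Sum>i\<in>D. real (card (I i))) - card (I k) - 2 * card D"
    and b1: "\<And>i. i \<in> D \<Longrightarrow> exp (- (p * card (I i)) / 2) * 2 powr m \<le> b1"
    and b2: "p\<^sup>2 * (exp ((\<theta> - 1) * p * M) * \<theta> powr (- (2 * real (card D) * m))) \<le> b2"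
    and b3: "\<And>i j. i \<in> D \<Longrightarrow> j \<in> D \<Longrightarrow>
      2 ^ card (I j) * (exp (- (p * (card (I i) * card (I j))) / 2) * 2 powr (m * card (I j))) \<le> b3"
    and b4: "\<And>i j. i \<in> D \<Longrightarrow> j \<in> D \<Longrightarrow>
      2 ^ (card (I i) + card (I j)) * (exp (- (p * (e\<^sup>2 * (card (I i) * card (I j)))) / 2) * 2) \<le> b4"
    and b5: "\<And>i. i \<in> D \<Longrightarrow> exp ((\<theta>' - 1) * p * (e * card (I i))) * \<theta>' powr (- m) \<le> b5"
  shows "measure_pmf.prob P {\<omega>. \<not> good_config e m i0 x0 \<omega>} \<le>
    b1 + N * (card D * A) * b2 + (card D)\<^sup>2 * N\<^sup>2 * b3 + (card D)\<^sup>2 * N * b4 + (card D)\<^sup>2 * N * b5"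
proof -
  let ?E1 = "{\<omega>. \<not> rich I m (Occ \<omega>) i0 x0}"
  let ?E2 = "{\<omega>. \<exists>q\<in>V \<times> (SIGMA k:D. I k). case q of (v, k, s) \<Rightarrow> s \<noteq> v k \<and> v \<in> Occ \<omega> \<and> v(k := s) \<in> Occ \<omega> \<and>
      real (card {x \<in> edge_nbhd D I v (v(k := s)). x \<in> Occ \<omega>}) < 2 * real (card D) * m}"
  let ?E3 = "{\<omega>. \<exists>q\<in>(D \<times> D) \<times> V \<times> V. case q of ((i, j), x, y) \<Rightarrow> i \<noteq> j \<and>
      \<not> (\<exists>t\<in>I j. rich I m (Occ \<omega>) i (x(j := t)) \<and> rich I m (Occ \<omega>) i (y(j := t)))}"
  let ?E4 = "{\<omega>. \<exists>q\<in>(D \<times> D) \<times> V. case q of ((i, j), y) \<Rightarrow> i \<noteq> j \<and> \<not> no_vacant_rectangle I e (Occ \<omega>) i j y}"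
  let ?E5 = "{\<omega>. \<exists>q\<in>(D \<times> D) \<times> V. case q of ((i, j), y) \<Rightarrow> i \<noteq> j \<and>
      \<not> real (card {s \<in> fst (max_small_union I e (Occ \<omega>) i j y). y(i := s) \<in> Occ \<omega>}) < m}"
  have b0: "0 \<le> b1" "0 \<le> b2" "0 \<le> b3" "0 \<le> b4" "0 \<le> b5"
    using b1[OF i0(1)] b2 b3[OF i0(1,1)] b4[OF i0(1,1)] b5[OF i0(1)]
    by (auto elim!: order_trans[rotated])
  have N0: "0 \<le> N" using N by linarith
  have finDI: "finite (SIGMA k:D. I k)" using finite_D finite_I by auto
  \<comment> \<open>The index sets are kept as products; degenerate indices with
    \<open>i = j\<close> or \<open>s = v k\<close> belong to the impossible event.\<close>
  have zero: "measure_pmf.prob P {\<omega>. False} = 0" by simp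
  have "{\<omega>. \<not> good_config e m i0 x0 \<omega>} \<subseteq> ?E1 \<union> ?E2 \<union> ?E3 \<union> ?E4 \<union> ?E5"
  proof
    fix \<omega>
    assume "\<omega> \<in> {\<omega>. \<not> good_config e m i0 x0 \<omega>}"
    then have "\<not> good_config e m i0 x0 \<omega>" by (rule CollectD)
    then consider (1) "\<not> rich I m (Occ \<omega>) i0 x0"
      | (2) k v s where "k \<in> D" "v \<in> Occ \<omega>" "s \<in> I k" "s \<noteq> v k" "v(k := s) \<in> Occ \<omega>"
         "\<not> 2 * real (card D) * m \<le> real (card {x \<in> edge_nbhd D I v (v(k := s)). x \<in> Occ \<omega>})"
      | (3) i j x y where "i \<in> D" "j \<in> D" "i \<noteq> j" "x \<in> V" "y \<in> V"
         "\<not> (\<exists>t\<in>I j. rich I m (Occ \<omega>) i (x(j := t)) \<and> rich I m (Occ \<omega>) i (y(j := t)))"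
      | (4) i j y where "i \<in> D" "j \<in> D" "i \<noteq> j" "y \<in> V" "\<not> no_vacant_rectangle I e (Occ \<omega>) i j y"
      | (5) i j y where "i \<in> D" "j \<in> D" "i \<noteq> j" "y \<in> V"
         "\<not> real (card {s \<in> fst (max_small_union I e (Occ \<omega>) i j y). y(i := s) \<in> Occ \<omega>}) < m"
      unfolding good_config_def by meson
    then show "\<omega> \<in> ?E1 \<union> ?E2 \<union> ?E3 \<union> ?E4 \<union> ?E5"
    proof cases
      case 1
      then show ?thesis by simp
    next
      case 2
      then have "\<omega> \<in> ?E2" by (intro CollectI bexI[of _ "(v, k, s)"]) auto
      then show ?thesis by blast
    next
      case 3
      then have "\<omega> \<in> ?E3" by (intro CollectI bexI[of _ "((i, j), x, y)"]) (simp_all only: split_conv mem_Times_iff fst_conv snd_conv simp_thms)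
      then show ?thesis by blast
    next
      case 4
      then have "\<omega> \<in> ?E4" by (intro CollectI bexI[of _ "((i, j), y)"]) (simp_all only: split_conv mem_Times_iff fst_conv snd_conv simp_thms)
      then show ?thesis by blast
    next
      case 5
      then have "\<omega> \<in> ?E5" by (intro CollectI bexI[of _ "((i, j), y)"]) (simp_all only: split_conv mem_Times_iff fst_conv snd_conv simp_thms)
      then show ?thesis by blast
    qed
  qed
  then have "measure_pmf.prob P {\<omega>. \<not> good_config e m i0 x0 \<omega>} \<le> measure_pmf.prob P (?E1 \<union> ?E2 \<union> ?E3 \<union> ?E4 \<union> ?E5)"
    by (intro measure_pmf.finite_measure_mono) auto
  also have "\<dots> \<le> measure_pmf.prob P ?E1 + measure_pmf.prob P ?E2 + measure_pmf.prob P ?E3 +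
      measure_pmf.prob P ?E4 + measure_pmf.prob P ?E5"
    by (intro order_trans[OF measure_Un_le] add_mono order_refl) auto
  finally have "measure_pmf.prob P {\<omega>. \<not> good_config e m i0 x0 \<omega>} \<le> \<dots>" .
  moreover have "measure_pmf.prob P ?E1 \<le> b1"
    by (rule order_trans[OF prob_not_rich[OF i0] b1[OF i0(1)]])
  moreover have "measure_pmf.prob P ?E2 \<le> N * (card D * A) * b2"
  proof -
    have "measure_pmf.prob P ?E2 \<le> card (V \<times> (SIGMA k:D. I k)) * b2"
    proof (rule prob_union_bound)
      fix q assume "q \<in> V \<times> (SIGMA k:D. I k)"
      then obtain v k s where q: "q = (v, k, s)" "v \<in> V" "k \<in> D" "s \<in> I k" by auto
      show "measure_pmf.prob P {\<omega>. case q of (v, k, s) \<Rightarrow> s \<noteq> v k \<and> v \<in> Occ \<omega> \<and> v(k := s) \<in> Occ \<omega> \<and>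
          real (card {x \<in> edge_nbhd D I v (v(k := s)). x \<in> Occ \<omega>}) < 2 * real (card D) * m} \<le> b2"
      proof (cases "s = v k")
        case True
        then show ?thesis using b0 zero by (simp only: q split_conv simp_thms)
      next
        case False
        have "M \<le> card (edge_nbhd D I v (v(k := s)))"
          using M[OF q(3)] card_edge_nbhd[where I = I, OF finite_D finite_I q(2,3,4) False] by linarith
        from order_trans[OF prob_sparse_edge[OF q(3,2,4) False th(1,2) this] b2]
        show ?thesis using False by (simp only: q split_conv simp_thms)
      qed
    qed (use finite_V finDI in simp)
    also have "\<dots> \<le> N * (card D * A) * b2"
    proof (rule mult_right_mono[OF _ b0(2)])
      have "real (card (SIGMA k:D. I k)) = (\<Sum>k\<in>D. real (card (I k)))"
        using finite_D finite_I by (subst card_SigmaI) auto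
      also have "\<dots> \<le> card D * A" using A sum_bounded_above[of D "\<lambda>k. real (card (I k))" A] by simp
      finally show "real (card (V \<times> (SIGMA k:D. I k))) \<le> N * (card D * A)"
        unfolding card_cartesian_product of_nat_mult using N N0 by (intro mult_mono) auto
    qed
    finally show ?thesis .
  qed
  moreover have "measure_pmf.prob P ?E3 \<le> (card D)\<^sup>2 * N\<^sup>2 * b3"
  proof -
    have "measure_pmf.prob P ?E3 \<le> card ((D \<times> D) \<times> V \<times> V) * b3"
    proof (rule prob_union_bound)
      fix q assume "q \<in> (D \<times> D) \<times> V \<times> V"
      then obtain i j x y where q: "q = ((i, j), x, y)" "i \<in> D" "j \<in> D" "x \<in> V" "y \<in> V"
        by (metis SigmaE)
      show "measure_pmf.prob P {\<omega>. case q of ((i, j), x, y) \<Rightarrow> i \<noteq> j \<and>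
        \<not> (\<exists>t\<in>I j. rich I m (Occ \<omega>) i (x(j := t)) \<and> rich I m (Occ \<omega>) i (y(j := t)))} \<le> b3"
      proof (cases "i = j")
        case True
        then show ?thesis using b0 zero by (simp only: q split_conv simp_thms)
      next
        case False
        from order_trans[OF prob_no_rich_pair[OF q(2,3) False q(4,5)] b3[OF q(2,3)]]
        show ?thesis using False by (simp only: q split_conv simp_thms)
      qed
    qed (use finite_V finite_D in simp)
    also have "\<dots> \<le> (card D)\<^sup>2 * N\<^sup>2 * b3"
      unfolding card_cartesian_product of_nat_mult using N N0 b0
      by (intro mult_right_mono) (auto simp: power2_eq_square intro!: mult_mono)
    finally show ?thesis .
  qed
  moreover have "measure_pmf.prob P ?E4 \<le> (card D)\<^sup>2 * N * b4"
  proof -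
    have "measure_pmf.prob P ?E4 \<le> card ((D \<times> D) \<times> V) * b4"
    proof (rule prob_union_bound)
      fix q assume "q \<in> (D \<times> D) \<times> V"
      then obtain i j y where q: "q = ((i, j), y)" "i \<in> D" "j \<in> D" "y \<in> V"
        by (metis SigmaE)
      show "measure_pmf.prob P {\<omega>. case q of ((i, j), y) \<Rightarrow> i \<noteq> j \<and>
        \<not> no_vacant_rectangle I e (Occ \<omega>) i j y} \<le> b4"
      proof (cases "i = j")
        case True
        then show ?thesis using b0 zero by (simp only: q split_conv simp_thms)
      next
        case False
        from order_trans[OF prob_vacant_rectangle[OF q(2,3) False q(4) less_imp_le[OF e]] b4[OF q(2,3)]]
        show ?thesis using False by (simp only: q split_conv simp_thms)
      qed
    qed (use finite_V finite_D in simp)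
    also have "\<dots> \<le> (card D)\<^sup>2 * N * b4"
      unfolding card_cartesian_product of_nat_mult using N N0 b0
      by (intro mult_right_mono) (auto simp: power2_eq_square intro!: mult_mono)
    finally show ?thesis .
  qed
  moreover have "measure_pmf.prob P ?E5 \<le> (card D)\<^sup>2 * N * b5"
  proof -
    have "measure_pmf.prob P ?E5 \<le> card ((D \<times> D) \<times> V) * b5"
    proof (rule prob_union_bound)
      fix q assume "q \<in> (D \<times> D) \<times> V"
      then obtain i j y where q: "q = ((i, j), y)" "i \<in> D" "j \<in> D" "y \<in> V"
        by (metis SigmaE)
      show "measure_pmf.prob P {\<omega>. case q of ((i, j), y) \<Rightarrow> i \<noteq> j \<and>
        \<not> real (card {s \<in> fst (max_small_union I e (Occ \<omega>) i j y). y(i := s) \<in> Occ \<omega>}) < m} \<le> b5"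
      proof (cases "i = j")
        case True
        then show ?thesis using b0 zero by (simp only: q split_conv simp_thms)
      next
        case False
        from order_trans[OF prob_many_exceptions[OF q(2,3) False q(4) e th(3)] b5[OF q(2)]]
        show ?thesis using False by (simp only: q split_conv simp_thms)
      qed
    qed (use finite_V finite_D in simp)
    also have "\<dots> \<le> (card D)\<^sup>2 * N * b5"
      unfolding card_cartesian_product of_nat_mult using N N0 b0
      by (intro mult_right_mono) (auto simp: power2_eq_square intro!: mult_mono)
    finally show ?thesis .
  qed
  ultimately show ?thesis by linarith
qed

end

section \<open>The Hamming torus\<close>

definition side :: "(nat \<Rightarrow> real) \<Rightarrow> nat \<Rightarrow> nat \<Rightarrow> int set" where
  "side a n i = {k::int. 1 \<le> k \<and> real_of_int k \<le> a i * real n}"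

lemma hamming_torus_verts_side: "hamming_torus_verts d a n = PiE {1..d} (side a n)"
  by (simp only: hamming_torus_verts_def side_def[abs_def])

lemma side_eq: "side a n i = {1..\<lfloor>a i * real n\<rfloor>}"
  by (auto simp: side_def le_floor_iff)

lemma finite_side: "finite (side a n i)"
  by (simp add: side_eq)

lemma card_side_bounds:
  assumes "0 \<le> a i"
  shows "a i * real n - 1 \<le> real (card (side a n i))" "real (card (side a n i)) \<le> a i * real n"
proof -
  have "0 \<le> a i * real n" using assms by simp
  then show "a i * real n - 1 \<le> real (card (side a n i))" "real (card (side a n i)) \<le> a i * real n"
    unfolding side_eq card_atLeastAtMost_int by linarith+
qed

lemma line_reachable:
  assumes i: "i \<in> {1..d}" and x: "x(i := s) \<in> {x \<in> hamming_torus_verts d a n. \<omega> x}"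
    "x(i := t) \<in> {x \<in> hamming_torus_verts d a n. \<omega> x}"
  shows "x(i := s) \<rightarrow>\<^sup>*\<^bsub>site_subgraph d a n \<omega>\<^esub> x(i := t)"
proof -
  interpret sym_digraph "site_subgraph d a n \<omega>" by (rule sym_digraph_site_subgraph)
  show ?thesis
  proof (cases "s = t")
    case True
    then show ?thesis using x by (simp add: verts_site_subgraph)
  next
    case False
    then have "{l \<in> {1..d}. (x(i := s)) l \<noteq> (x(i := t)) l} = {i}" using i by auto
    then have "x(i := s) \<rightarrow>\<^bsub>site_subgraph d a n \<omega>\<^esub> x(i := t)"
      using x unfolding dominates_site_subgraph by simp
    then show ?thesis by auto
  qed
qed

lemma good_config_imp_giant:
  fixes e m :: real
  assumes d: "1 \<le> d" and n: "\<And>i. i \<in> {1..d} \<Longrightarrow> 2 \<le> card (side a n i)"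
    and e: "0 < e" "e \<le> 1/4" and m: "1 < m"
    and x0: "x0 \<in> hamming_torus_verts d a n"
    and good: "percolation_grid.good_config {1..d} (side a n) e m 1 x0 \<omega>"
  defines "G \<equiv> site_subgraph d a n \<omega>"
  shows "\<exists>C. is_giant_component G C \<and> (\<forall>v\<in>verts G. isolated_vertex G v \<or> v \<in> C)"
proof -
  let ?D = "{1..d}" and ?I = "side a n"
  have D1: "1 \<in> ?D" using d by simp
  have ne: "?I i \<noteq> {}" if "i \<in> ?D" for i using n[OF that] by auto
  \<comment> \<open>\<open>good_config\<close> speaks of a single configuration, so any probability
    serves here; 0 is chosen.\<close>
  interpret percolation_grid ?D ?I 0
    by standard (use finite_side ne in auto)
  interpret G: sym_digraph G unfolding G_def by (rule sym_digraph_site_subgraph)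
  have vG: "verts G = Occ \<omega>" by (simp add: G_def verts_site_subgraph hamming_torus_verts_side)
  note gc = good[unfolded good_config_def]
  interpret good_grid ?D ?I "Occ \<omega>" "\<lambda>x y. x \<rightarrow>\<^sup>*\<^bsub>G\<^esub> y" e m
  proof
    show "\<And>x y. x \<rightarrow>\<^sup>*\<^bsub>G\<^esub> y \<Longrightarrow> y \<rightarrow>\<^sup>*\<^bsub>G\<^esub> x" using symmetric_reachable[OF G.sym_arcs] .
    show "\<And>x y z. x \<rightarrow>\<^sup>*\<^bsub>G\<^esub> y \<Longrightarrow> y \<rightarrow>\<^sup>*\<^bsub>G\<^esub> z \<Longrightarrow> x \<rightarrow>\<^sup>*\<^bsub>G\<^esub> z" by (rule G.reachable_trans)
    show "x(i := s) \<rightarrow>\<^sup>*\<^bsub>G\<^esub> x(i := t)"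
      if "i \<in> ?D" "x(i := s) \<in> Occ \<omega>" "x(i := t) \<in> Occ \<omega>" for i x s t
      using line_reachable[of i d x s a n \<omega> t] that by (simp add: G_def hamming_torus_verts_side)
    show "2 * real (card ?D) * m \<le> real (card {x \<in> edge_nbhd ?D ?I v (v(k := s)). x \<in> Occ \<omega>})"
      if "k \<in> ?D" "v \<in> Occ \<omega>" "s \<in> ?I k" "s \<noteq> v k" "v(k := s) \<in> Occ \<omega>" for k v s
      using conjunct1[OF conjunct2[OF gc]] that by blast
    show "\<exists>t\<in>?I j. rich ?I m (Occ \<omega>) i (x(j := t)) \<and> rich ?I m (Occ \<omega>) i (y(j := t))"
      if "i \<in> ?D" "j \<in> ?D" "i \<noteq> j" "x \<in> V" "y \<in> V" for i j x y
      using conjunct1[OF conjunct2[OF conjunct2[OF gc]]] that by blast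
    show "no_vacant_rectangle ?I e (Occ \<omega>) i j y"
      if "i \<in> ?D" "j \<in> ?D" "i \<noteq> j" "y \<in> V" for i j y
      using conjunct1[OF conjunct2[OF conjunct2[OF conjunct2[OF gc]]]] that by blast
    show "real (card {s \<in> fst (max_small_union ?I e (Occ \<omega>) i j y). y(i := s) \<in> Occ \<omega>}) < m"
      if "i \<in> ?D" "j \<in> ?D" "i \<noteq> j" "y \<in> V" for i j y
      using conjunct2[OF conjunct2[OF conjunct2[OF conjunct2[OF gc]]]] that by blast
  qed (use finite_side n e m in auto)
  have x0V: "x0 \<in> V" using x0 by (simp add: hamming_torus_verts_side)
  show ?thesis
  proof (rule single_class[OF D1 x0V conjunct1[OF gc]])
    fix w w'
    assume w: "w \<in> Occ \<omega>" "w' \<in> Occ \<omega>" "w \<noteq> w'" "w \<rightarrow>\<^sup>*\<^bsub>G\<^esub> w'"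
      and edge: "\<And>v k s. v \<in> Occ \<omega> \<Longrightarrow> k \<in> ?D \<Longrightarrow> s \<in> ?I k \<Longrightarrow> s \<noteq> v k \<Longrightarrow> v(k := s) \<in> Occ \<omega> \<Longrightarrow> w \<rightarrow>\<^sup>*\<^bsub>G\<^esub> v"
    show ?thesis
    proof (rule giant_component_exists[of G w' w])
      show "isolated_vertex G v \<or> w \<rightarrow>\<^sup>*\<^bsub>G\<^esub> v" if v: "v \<in> verts G" for v
      proof (cases "isolated_vertex G v")
        case False
        then obtain u where "v \<rightarrow>\<^bsub>G\<^esub> u" using v by (auto simp: isolated_vertex_def)
        then have u: "v \<in> Occ \<omega>" "u \<in> Occ \<omega>" "card {i \<in> ?D. v i \<noteq> u i} = 1"
          by (auto simp: G_def dominates_site_subgraph hamming_torus_verts_side)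
        then obtain k where k: "k \<in> ?D" "u k \<noteq> v k" "u = v(k := u k)"
          using differ_in_one_coordinate[of v ?D ?I u] by blast
        have "u k \<in> ?I k" using u(2) k(1) by auto
        moreover have "v(k := u k) \<in> Occ \<omega>" unfolding k(3)[symmetric] by (rule u(2))
        ultimately show ?thesis using edge[OF u(1) k(1) _ k(2)] by simp
      qed simp
    qed (use w vG finite_V in \<open>auto simp: G.sym_digraph_axioms\<close>)
  qed
qed

section \<open>Limits of the error terms\<close>

lemma
  fixes \<delta> C K :: real
  assumes "0 < \<delta>"
  shows exp_neg_ln_tendsto_0: "(\<lambda>n::nat. C * exp (K - \<delta> * ln n)) \<longlonglongrightarrow> 0"
    and ln_squared_exp_neg_ln_tendsto_0: "(\<lambda>n::nat. C * ((ln n)\<^sup>2 * exp (K - \<delta> * ln n))) \<longlonglongrightarrow> 0"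
proof -
  show "(\<lambda>n::nat. C * exp (K - \<delta> * ln n)) \<longlonglongrightarrow> 0" using assms by real_asymp
  show "(\<lambda>n::nat. C * ((ln n)\<^sup>2 * exp (K - \<delta> * ln n))) \<longlonglongrightarrow> 0" using assms by real_asymp
qed

text \<open>The exponent is of order \<open>- \<alpha> * \<delta> * n * ln n\<close>, which beats
  the linear term. So the exponentially many choices in the union bounds are harmless.\<close>

lemma exp_neg_linear_ln_tendsto_0:
  fixes \<alpha> \<delta> C K K' B :: real
  assumes "0 < \<delta>" "0 < \<alpha>"
  shows "(\<lambda>n::nat. C * exp (K * ln n + B * n + (\<alpha> * n - 1) * (K' - \<delta> * ln n))) \<longlonglongrightarrow> 0"
proof -
  have "filterlim (\<lambda>n::nat. K * ln n + B * n + (\<alpha> * n - 1) * (K' - \<delta> * ln n)) at_bot sequentially"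
    using assms by real_asymp
  then have "(\<lambda>n::nat. exp (K * ln n + B * n + (\<alpha> * n - 1) * (K' - \<delta> * ln n))) \<longlonglongrightarrow> 0"
    by (rule filterlim_compose[OF exp_at_bot])
  then show ?thesis by (rule tendsto_mult_right_zero)
qed

text \<open>The richness threshold is \<open>\<eta> * L\<close>; the five summands are the bounds of
  \<open>prob_not_good_config\<close> in their order.\<close>

lemma prob_not_good_torus:
  fixes d n :: nat and a :: "nat \<Rightarrow> real" and c e \<alpha> \<beta> \<eta> \<theta> \<theta>' :: real
  assumes d: "1 \<le> d" and a: "\<And>i. i \<in> {1..d} \<Longrightarrow> \<alpha> \<le> a i" "\<And>i. i \<in> {1..d} \<Longrightarrow> a i \<le> \<beta>" and \<alpha>: "0 < \<alpha>"
    and c: "0 < c" and e: "0 < e" and \<eta>: "0 \<le> \<eta>" "\<eta> * ln 2 \<le> c * \<alpha> / 4"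
    and th: "0 < \<theta>" "\<theta> \<le> 1" "1 \<le> \<theta>'"
    and \<theta>': "(\<theta>' - 1) * c * e * \<beta> \<le> 1" "\<eta> * ln \<theta>' = real d + 2"
    and n: "1 \<le> n" "c * ln n / n \<le> 1" "1 \<le> \<alpha> * n" "ln 2 + c / 2 \<le> c * \<alpha> / 4 * ln n"
    and x0: "x0 \<in> hamming_torus_verts d a n"
  defines "L \<equiv> ln (real n)"
  defines "\<kappa> \<equiv> c * (2 * (\<Sum>i=1..d. a i) - \<beta>)"
  shows "measure_pmf.prob (site_percolation d a n (c * ln n / n))
      {\<omega>. \<not> percolation_grid.good_config {1..d} (side a n) e (\<eta> * L) 1 x0 \<omega>} \<le>
    exp (c / 2 - (c * \<alpha> / 2 - \<eta> * ln 2) * L) +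
    (\<beta> * n) ^ d * (d * (\<beta> * n)) * ((c * L / n)\<^sup>2 * exp (4 * d * c - ((1 - \<theta>) * \<kappa> + 2 * d * \<eta> * ln \<theta>) * L)) +
    d\<^sup>2 * ((\<beta> * n) ^ d)\<^sup>2 * exp ((\<alpha> * n - 1) * (ln 2 + c / 2 - c * \<alpha> / 4 * L)) +
    d\<^sup>2 * (\<beta> * n) ^ d * (2 * exp (2 * (\<beta> * n) * ln 2 + (\<alpha> * n - 1) * (e\<^sup>2 * c / 2 - e\<^sup>2 * c * \<alpha> / 2 * L))) +
    d\<^sup>2 * (\<beta> * n) ^ d * exp (- (real d + 1) * L)"
proof -
  let ?D = "{1..d}" and ?I = "side a n"
  define p where "p = c * ln n / n"
  have n0: "0 < real n" using n by simp
  have L0: "0 \<le> L" using n by (simp add: L_def)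
  have "ln (real n) \<le> real n - 1" using n0 by (rule ln_le_minus_one)
  then have Ln: "L \<le> n" by (simp add: L_def)
  have p01: "0 \<le> p" "p \<le> 1" using n c by (auto simp: p_def)
  have pn: "p * n = c * L" using n0 by (simp add: p_def L_def)
  \<comment> \<open>A bounded number of sites, lost for instance by rounding, thus changes
    \<open>p\<close> times a count only by a bounded amount.\<close>
  have pc: "p \<le> c" using Ln n0 c by (simp add: p_def L_def[symmetric] field_simps)
  have a0: "0 \<le> a i" if "i \<in> ?D" for i using a(1)[OF that] \<alpha> by simp
  have ge: "\<alpha> * n - 1 \<le> card (?I i)" if "i \<in> ?D" for i
    using card_side_bounds(1)[of a i n, OF a0[OF that]] mult_right_mono[OF a(1)[OF that], of "real n"] n0 by linarith
  have le: "card (?I i) \<le> \<beta> * n" if "i \<in> ?D" for i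
    using card_side_bounds(2)[of a i n, OF a0[OF that]] mult_right_mono[OF a(2)[OF that], of "real n"] n0 by linarith
  have pge: "c * \<alpha> * L - c \<le> p * card (?I i)" if "i \<in> ?D" for i
  proof -
    have "p * (\<alpha> * n - 1) = \<alpha> * (p * n) - p" by (simp add: algebra_simps)
    then show ?thesis using mult_left_mono[OF ge[OF that] p01(1)] pc unfolding pn by (simp add: mult_ac)
  qed
  have ne: "?I i \<noteq> {}" if "i \<in> ?D" for i
    using x0 that unfolding hamming_torus_verts_side by auto
  have two: "2 powr x = exp (x * ln 2)" for x :: real by (simp add: powr_def)
  have two_pow: "(2::real) ^ k = exp (k * ln 2)" for k
    by (simp add: powr_realpow[symmetric] two)
  interpret percolation_grid ?D ?I p
    by standard (use finite_side ne p01 in auto)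
  have cardV: "card V \<le> (\<beta> * n) ^ d"
  proof -
    have "real (card V) = (\<Prod>i\<in>?D. real (card (?I i)))" by (simp add: card_PiE)
    also have "\<dots> \<le> (\<Prod>i\<in>?D. \<beta> * n)" using le by (intro prod_mono) auto
    finally show ?thesis by simp
  qed
  have "measure_pmf.prob P {\<omega>. \<not> good_config e (\<eta> * L) 1 x0 \<omega>} \<le>
    exp (c / 2 - (c * \<alpha> / 2 - \<eta> * ln 2) * L) +
    (\<beta> * n) ^ d * (card ?D * (\<beta> * n)) * ((c * L / n)\<^sup>2 * exp (4 * d * c - ((1 - \<theta>) * \<kappa> + 2 * d * \<eta> * ln \<theta>) * L)) +
    (card ?D)\<^sup>2 * ((\<beta> * n) ^ d)\<^sup>2 * exp ((\<alpha> * n - 1) * (ln 2 + c / 2 - c * \<alpha> / 4 * L)) +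
    (card ?D)\<^sup>2 * (\<beta> * n) ^ d * (2 * exp (2 * (\<beta> * n) * ln 2 + (\<alpha> * n - 1) * (e\<^sup>2 * c / 2 - e\<^sup>2 * c * \<alpha> / 2 * L))) +
    (card ?D)\<^sup>2 * (\<beta> * n) ^ d * exp (- (real d + 1) * L)"
  \<comment> \<open>Of the \<open>4 * d\<close>, one half comes from rounding the sides and the
    other from \<open>card_edge_nbhd\<close>; the shared line has at most \<open>\<beta> * n\<close>
    sites.\<close>
  proof (rule prob_not_good_config[where M = "(2 * (\<Sum>i=1..d. a i) - \<beta>) * n - 4 * d" and \<theta> = \<theta> and \<theta>' = \<theta>'])
    show "1 \<in> ?D" "x0 \<in> V" using d x0 by (auto simp: hamming_torus_verts_side)
    show "(2 * (\<Sum>i=1..d. a i) - \<beta>) * n - 4 * d \<le> 2 * (\<Sum>i\<in>?D. real (card (?I i))) - card (?I k) - 2 * card ?D"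
      if "k \<in> ?D" for k
    proof -
      have "(\<Sum>i\<in>?D. a i * n - 1) \<le> (\<Sum>i\<in>?D. real (card (?I i)))"
        by (intro sum_mono card_side_bounds(1) a0)
      then have "(\<Sum>i\<in>?D. a i) * n - d \<le> (\<Sum>i\<in>?D. real (card (?I i)))"
        by (simp add: sum_subtractf sum_distrib_right)
      then show ?thesis using le[OF that] by (simp add: algebra_simps)
    qed
    show "exp (- (p * card (?I i)) / 2) * 2 powr (\<eta> * L) \<le> exp (c / 2 - (c * \<alpha> / 2 - \<eta> * ln 2) * L)"
      if "i \<in> ?D" for i
      using pge[OF that] by (simp add: two exp_add[symmetric] algebra_simps)
    show "p\<^sup>2 * (exp ((\<theta> - 1) * p * ((2 * (\<Sum>i=1..d. a i) - \<beta>) * n - 4 * d)) * \<theta> powr - (2 * real (card ?D) * (\<eta> * L))) \<le>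
        (c * L / n)\<^sup>2 * exp (4 * d * c - ((1 - \<theta>) * \<kappa> + 2 * d * \<eta> * ln \<theta>) * L)"
    proof -
      have "(\<theta> - 1) * p * ((2 * (\<Sum>i=1..d. a i) - \<beta>) * n - 4 * d) =
          (\<theta> - 1) * (2 * (\<Sum>i=1..d. a i) - \<beta>) * (p * n) + (1 - \<theta>) * p * (4 * d)"
        by (simp add: algebra_simps)
      also have "\<dots> \<le> - (1 - \<theta>) * \<kappa> * L + 4 * d * c"
      proof -
        have "(1 - \<theta>) * p \<le> 1 * c" using th pc p01 by (intro mult_mono) auto
        then have "(1 - \<theta>) * p * (4 * d) \<le> c * (4 * d)" by (intro mult_right_mono) auto
        then show ?thesis unfolding pn \<kappa>_def by (simp add: algebra_simps)
      qed
      finally have "exp ((\<theta> - 1) * p * ((2 * (\<Sum>i=1..d. a i) - \<beta>) * n - 4 * d)) * \<theta> powr - (2 * real (card ?D) * (\<eta> * L))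
          \<le> exp (- (1 - \<theta>) * \<kappa> * L + 4 * d * c) * exp (- (2 * d * (\<eta> * L)) * ln \<theta>)"
        using th by (simp add: powr_def)
      also have "\<dots> = exp (4 * d * c - ((1 - \<theta>) * \<kappa> + 2 * d * \<eta> * ln \<theta>) * L)"
        unfolding exp_add[symmetric] by (simp add: algebra_simps)
      finally show ?thesis by (simp add: p_def L_def mult_left_mono)
    qed
    show "2 ^ card (?I j) * (exp (- (p * (card (?I i) * card (?I j))) / 2) * 2 powr (\<eta> * L * card (?I j)))
        \<le> exp ((\<alpha> * n - 1) * (ln 2 + c / 2 - c * \<alpha> / 4 * L))" if "i \<in> ?D" "j \<in> ?D" for i j
    proof -
      have "2 ^ card (?I j) * (exp (- (p * (card (?I i) * card (?I j))) / 2) * 2 powr (\<eta> * L * card (?I j)))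
        = exp (card (?I j) * (ln 2 - p * card (?I i) / 2 + \<eta> * ln 2 * L))"
        unfolding two two_pow exp_add[symmetric] by (simp add: algebra_simps)
      \<comment> \<open>The bound on \<eta> lets the threshold consume at most half of the decay
        rate \<open>c * \<alpha> / 2\<close>.\<close>
      also have "\<dots> \<le> exp (card (?I j) * (ln 2 + c / 2 - c * \<alpha> / 4 * L))"
      proof -
        have "\<eta> * ln 2 * L \<le> c * \<alpha> / 4 * L" using \<eta>(2) L0 by (rule mult_right_mono)
        then have "ln 2 - p * card (?I i) / 2 + \<eta> * ln 2 * L \<le> ln 2 + c / 2 - c * \<alpha> / 4 * L"
          using pge[OF that(1)] by (simp add: algebra_simps)
        then show ?thesis by (simp add: mult_left_mono)
      qed
      \<comment> \<open>By \<open>n(4)\<close> the bracket is not positive, so the smaller first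
        factor gives the larger product.\<close>
      also have "\<dots> \<le> exp ((\<alpha> * n - 1) * (ln 2 + c / 2 - c * \<alpha> / 4 * L))"
        using ge[OF that(2)] n(4) by (simp add: L_def mult_right_mono_neg)
      finally show ?thesis .
    qed
    show "2 ^ (card (?I i) + card (?I j)) * (exp (- (p * (e\<^sup>2 * (card (?I i) * card (?I j)))) / 2) * 2)
        \<le> 2 * exp (2 * (\<beta> * n) * ln 2 + (\<alpha> * n - 1) * (e\<^sup>2 * c / 2 - e\<^sup>2 * c * \<alpha> / 2 * L))"
      if "i \<in> ?D" "j \<in> ?D" for i j
    proof -
      have "(\<alpha> * n - 1) * (c * \<alpha> * L - c) \<le> card (?I j) * (p * card (?I i))"
      proof (rule mult_mono[OF ge[OF that(2)] pge[OF that(1)]])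
        have "0 \<le> (ln 2 :: real)" by simp
        moreover have "c * \<alpha> * L = 4 * (c * \<alpha> / 4 * L)" by simp
        ultimately show "0 \<le> c * \<alpha> * L - c" using n(4) c unfolding L_def by linarith
      qed simp
      then have le_e: "e\<^sup>2 * ((\<alpha> * n - 1) * (c * \<alpha> * L - c)) \<le> e\<^sup>2 * (card (?I j) * (p * card (?I i)))"
        by (rule mult_left_mono) simp
      have "- (p * (e\<^sup>2 * (card (?I i) * card (?I j)))) / 2 \<le> (\<alpha> * n - 1) * (e\<^sup>2 * c / 2 - e\<^sup>2 * c * \<alpha> / 2 * L)"
      proof -
        have "(\<alpha> * n - 1) * (e\<^sup>2 * c / 2 - e\<^sup>2 * c * \<alpha> / 2 * L) = - (e\<^sup>2 * ((\<alpha> * n - 1) * (c * \<alpha> * L - c))) / 2"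
          by (simp add: field_simps)
        moreover have "p * (e\<^sup>2 * (card (?I i) * card (?I j))) = e\<^sup>2 * (card (?I j) * (p * card (?I i)))" by simp
        ultimately show ?thesis using le_e by linarith
      qed
      moreover have "real (card (?I i) + card (?I j)) * ln 2 \<le> 2 * (\<beta> * n) * ln 2"
        using le[OF that(1)] le[OF that(2)] by (intro mult_right_mono) auto
      ultimately have "real (card (?I i) + card (?I j)) * ln 2 + - (p * (e\<^sup>2 * (card (?I i) * card (?I j)))) / 2
          \<le> 2 * (\<beta> * n) * ln 2 + (\<alpha> * n - 1) * (e\<^sup>2 * c / 2 - e\<^sup>2 * c * \<alpha> / 2 * L)"
        by (rule add_mono[rotated])
      then have "2 * exp (real (card (?I i) + card (?I j)) * ln 2 + - (p * (e\<^sup>2 * (card (?I i) * card (?I j)))) / 2)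
          \<le> 2 * exp (2 * (\<beta> * n) * ln 2 + (\<alpha> * n - 1) * (e\<^sup>2 * c / 2 - e\<^sup>2 * c * \<alpha> / 2 * L))"
        by simp
      then show ?thesis by (simp only: two_pow exp_add mult_ac)
    qed
    show "exp ((\<theta>' - 1) * p * (e * card (?I i))) * \<theta>' powr - (\<eta> * L) \<le> exp (- (real d + 1) * L)"
      if "i \<in> ?D" for i
    proof -
      have "(\<theta>' - 1) * p * (e * card (?I i)) \<le> (\<theta>' - 1) * p * (e * (\<beta> * n))"
        using le[OF that] th p01 e by (intro mult_left_mono) auto
      also have "\<dots> = (\<theta>' - 1) * c * e * \<beta> * L"
      proof -
        have "(\<theta>' - 1) * p * (e * (\<beta> * n)) = (\<theta>' - 1) * e * \<beta> * (p * n)" by simp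
        then show ?thesis unfolding pn by simp
      qed
      also have "\<dots> \<le> 1 * L" using \<theta>'(1) L0 by (rule mult_right_mono)
      finally have "exp ((\<theta>' - 1) * p * (e * card (?I i))) * \<theta>' powr - (\<eta> * L) \<le> exp L * exp (- (\<eta> * ln \<theta>') * L)"
        using th by (simp add: powr_def mult_ac)
      \<comment> \<open>The mean costs one of the \<open>d + 2\<close> powers of \<open>n\<close>;
        the remaining \<open>d + 1\<close> exceed by one the order of the number of planes.\<close>
      also have "\<dots> = exp (- (real d + 1) * L)"
        unfolding \<theta>'(2) exp_add[symmetric] by (simp add: algebra_simps)
      finally show ?thesis .
    qed
  qed (use e th le cardV in auto)
  then show ?thesis
    by (simp add: site_percolation_def hamming_torus_verts_side p_def)
qed

section \<open>Choice of the constants and passage to the limit\<close>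

theorem theorem1p6:
  fixes d :: nat and a :: "nat \<Rightarrow> real" and c :: real
  assumes "d \<ge> 1"
    and "\<And>i j. 1 \<le> i \<Longrightarrow> i \<le> j \<Longrightarrow> j \<le> d \<Longrightarrow> a j \<le> a i"
    and "a d > 0"
    and "c > (real d - 1) / (2 * (\<Sum>i=2..d. a i) + a 1)"
  shows "(\<lambda>n::nat. measure_pmf.prob (site_percolation d a n (c * ln (real n) / real n))
            {\<omega>. \<exists>C. is_giant_component (site_subgraph d a n \<omega>) C \<and>
                 (\<forall>v \<in> verts (site_subgraph d a n \<omega>).
                    isolated_vertex (site_subgraph d a n \<omega>) v \<or> v \<in> C)})
         \<longlonglongrightarrow> 1"
proof -
  define \<alpha> \<beta> where "\<alpha> = a d" and "\<beta> = a 1"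
  define \<kappa> where "\<kappa> = c * (2 * (\<Sum>i=1..d. a i) - \<beta>)"
  have \<alpha>: "0 < \<alpha>" using assms(3) by (simp add: \<alpha>_def)
  have a: "\<alpha> \<le> a i" "a i \<le> \<beta>" if "i \<in> {1..d}" for i
    using that assms(2)[of i d] assms(2)[of 1 i] by (auto simp: \<alpha>_def \<beta>_def)
  have \<beta>: "0 < \<beta>" using a[of 1] \<alpha> assms(1) by auto
  have "(\<Sum>i=1..d. a i) = a 1 + (\<Sum>i=2..d. a i)"
    using assms(1) sum.atLeast_Suc_atMost[of 1 d a] by (simp add: numeral_2_eq_2)
  then have S: "2 * (\<Sum>i=2..d. a i) + a 1 = 2 * (\<Sum>i=1..d. a i) - \<beta>" by (simp add: \<beta>_def)
  have "0 \<le> (\<Sum>i=2..d. a i)" using a \<alpha> by (intro sum_nonneg) (force intro: order_trans[of 0 \<alpha>])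
  then have S0: "0 < 2 * (\<Sum>i=2..d. a i) + a 1" using \<beta> by (simp add: \<beta>_def)
  have "0 \<le> (real d - 1) / (2 * (\<Sum>i=2..d. a i) + a 1)" using S0 assms(1) by simp
  then have c: "0 < c" using assms(4) by linarith
  \<comment> \<open>Here the hypothesis on \<open>c\<close> enters: up to a constant,
    \<open>\<kappa> * ln n\<close> is a lower bound for the mean number of occupied sites around an
    edge.\<close>
  have \<kappa>: "real d - 1 < \<kappa>"
    using assms(4) S0 unfolding \<kappa>_def S[symmetric] by (simp add: pos_divide_less_eq mult.commute)
  then have \<kappa>0: "0 < \<kappa>" using assms(1) by linarith
  \<comment> \<open>The gap between \<kappa> and \<open>d - 1\<close> is four times \<gamma>. The
    positive \<theta> uses up two parts and \<eta> at most one, so the decay exponent \<delta> below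
    is at least \<gamma>.\<close>
  define \<gamma> where "\<gamma> = (\<kappa> - (real d - 1)) / 4"
  define \<theta> where "\<theta> = 2 * \<gamma> / \<kappa>"
  have \<gamma>: "0 < \<gamma>" using \<kappa> by (simp add: \<gamma>_def)
  have th: "0 < \<theta>" "\<theta> < 1" using \<gamma> \<kappa>0 \<kappa> assms(1) by (auto simp: \<theta>_def \<gamma>_def field_simps)
  have thk: "(1 - \<theta>) * \<kappa> = (real d - 1) + 2 * \<gamma>" using \<kappa>0 by (simp add: \<theta>_def \<gamma>_def field_simps)
  have ln\<theta>: "ln \<theta> < 0" using th by simp
  \<comment> \<open>The first bound keeps the factor \<open>2 powr m\<close> below the decay of the
    lower tails; the second keeps the price of the threshold in the edge estimate below
    \<open>n powr \<gamma>\<close>.\<close>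
  define \<eta> where "\<eta> = min (c * \<alpha> / (4 * ln 2)) (\<gamma> / (2 * d * (- ln \<theta>)))"
  have d0: "0 < real d" using assms(1) by simp
  have dln: "0 < 2 * d * (- ln \<theta>)" using d0 ln\<theta> by (simp add: zero_less_mult_iff mult_less_0_iff)
  have \<eta>: "0 < \<eta>" unfolding \<eta>_def min_less_iff_conj using c \<alpha> \<gamma> dln by (intro conjI divide_pos_pos) auto
  have "\<eta> \<le> c * \<alpha> / (4 * ln 2)" by (simp add: \<eta>_def)
  then have \<eta>2: "\<eta> * ln 2 \<le> c * \<alpha> / 4" by (simp add: field_simps)
  have "\<eta> \<le> \<gamma> / (2 * d * (- ln \<theta>))" by (simp only: \<eta>_def min.cobounded2)
  then have "\<eta> * (2 * d * (- ln \<theta>)) \<le> \<gamma>" using dln by (simp only: pos_le_divide_eq)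
  then have \<eta>\<theta>: "- \<gamma> \<le> 2 * d * \<eta> * ln \<theta>" by (simp add: algebra_simps)
  \<comment> \<open>Chosen after \<eta> so that \<open>\<theta>' powr (- m)\<close> is
    \<open>n powr (- (d + 2))\<close>.\<close>
  define \<theta>' where "\<theta>' = exp ((real d + 2) / \<eta>)"
  have \<theta>': "1 < \<theta>'" "\<eta> * ln \<theta>' = real d + 2" using \<eta> by (auto simp: \<theta>'_def)
  \<comment> \<open>Chosen last: a tiny proportion of exceptional columns compensates for the
    possibly huge \<theta>'.\<close>
  define e where "e = min (1/4) (1 / ((\<theta>' - 1) * c * \<beta>))"
  have pos: "0 < (\<theta>' - 1) * c * \<beta>" using \<theta>' c \<beta> by simp
  then have e: "0 < e" "e \<le> 1/4" by (auto simp: e_def)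
  have "e \<le> 1 / ((\<theta>' - 1) * c * \<beta>)" by (simp add: e_def)
  then have e\<theta>: "(\<theta>' - 1) * c * e * \<beta> \<le> 1" using pos by (simp add: pos_le_divide_eq mult_ac)
  define T where "T = (\<lambda>n::nat.
    exp (c / 2 - (c * \<alpha> / 2 - \<eta> * ln 2) * ln n) +
    (\<beta> * n) ^ d * (d * (\<beta> * n)) * ((c * ln n / n)\<^sup>2 * exp (4 * d * c - ((1 - \<theta>) * \<kappa> + 2 * d * \<eta> * ln \<theta>) * ln n)) +
    d\<^sup>2 * ((\<beta> * n) ^ d)\<^sup>2 * exp ((\<alpha> * n - 1) * (ln 2 + c / 2 - c * \<alpha> / 4 * ln n)) +
    d\<^sup>2 * (\<beta> * n) ^ d * (2 * exp (2 * (\<beta> * n) * ln 2 + (\<alpha> * n - 1) * (e\<^sup>2 * c / 2 - e\<^sup>2 * c * \<alpha> / 2 * ln n))) +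
    d\<^sup>2 * (\<beta> * n) ^ d * exp (- (real d + 1) * ln n))"
  let ?A = "\<lambda>n. {\<omega>. \<exists>C. is_giant_component (site_subgraph d a n \<omega>) C \<and>
     (\<forall>v \<in> verts (site_subgraph d a n \<omega>). isolated_vertex (site_subgraph d a n \<omega>) v \<or> v \<in> C)}"
  let ?P = "\<lambda>n::nat. site_percolation d a n (c * ln (real n) / real n)"
  have ev: "eventually (\<lambda>n::nat. 1 \<le> n) sequentially" by (rule eventually_ge_at_top)
  have lower: "eventually (\<lambda>n. 1 - T n \<le> measure_pmf.prob (?P n) (?A n)) sequentially"
  proof -
    have "eventually (\<lambda>n::nat. c * ln n / n \<le> 1) sequentially" using c by real_asymp
    \<comment> \<open>After rounding, every side still has at least two elements.\<close>
    moreover have "eventually (\<lambda>n::nat. 3 \<le> \<alpha> * n) sequentially" using \<alpha> by real_asymp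
    moreover have "eventually (\<lambda>n::nat. ln 2 + c / 2 \<le> c * \<alpha> / 4 * ln n) sequentially" using c \<alpha> by real_asymp
    moreover have "eventually (\<lambda>n::nat. 1 < \<eta> * ln n) sequentially" using \<eta> by real_asymp
    ultimately show ?thesis using ev
    proof eventually_elim
      case (elim n)
      have card2: "2 \<le> card (side a n i)" if "i \<in> {1..d}" for i
      proof -
        have "0 \<le> a i" "\<alpha> * n \<le> a i * n" using a(1)[OF that] \<alpha> by (auto intro: mult_right_mono)
        then show ?thesis using card_side_bounds(1)[of a i n] elim(2) by linarith
      qed
      have "hamming_torus_verts d a n \<noteq> {}"
        using card2 unfolding hamming_torus_verts_side PiE_eq_empty_iff by fastforce
      then obtain x0 where x0: "x0 \<in> hamming_torus_verts d a n" by blast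
      let ?B = "{\<omega>. \<not> percolation_grid.good_config {1..d} (side a n) e (\<eta> * ln n) 1 x0 \<omega>}"
      have "measure_pmf.prob (?P n) ?B \<le> T n"
        unfolding T_def \<kappa>_def
        by (rule prob_not_good_torus) (use assms(1) a \<alpha> c e \<eta> \<eta>2 th \<theta>' e\<theta> elim x0 in auto)
      moreover have "measure_pmf.prob (?P n) (- ?B) \<le> measure_pmf.prob (?P n) (?A n)"
        using good_config_imp_giant[OF assms(1) card2 e elim(4) x0]
        by (intro measure_pmf.finite_measure_mono) auto
      moreover have "measure_pmf.prob (?P n) (- ?B) = 1 - measure_pmf.prob (?P n) ?B"
        using measure_pmf.prob_compl[of ?B "?P n"] by (simp add: Compl_eq_Diff_UNIV)
      ultimately show ?case by linarith
    qed
  qed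
  have "T \<longlonglongrightarrow> 0"
  proof -
    have "0 < c * \<alpha> / 2 - \<eta> * ln 2" using \<eta>2 mult_pos_pos[OF c \<alpha>] by linarith
    then have t1: "(\<lambda>n::nat. 1 * exp (c / 2 - (c * \<alpha> / 2 - \<eta> * ln 2) * ln n)) \<longlonglongrightarrow> 0" by (rule exp_neg_ln_tendsto_0)
    define \<delta> where "\<delta> = 2 * \<gamma> + 2 * d * \<eta> * ln \<theta>"
    have "0 < \<delta>" using \<eta>\<theta> \<gamma> by (simp add: \<delta>_def)
    then have t2: "(\<lambda>n::nat. \<beta> ^ d * d * \<beta> * c\<^sup>2 * ((ln n)\<^sup>2 * exp (4 * d * c - \<delta> * ln n))) \<longlonglongrightarrow> 0"
      by (rule ln_squared_exp_neg_ln_tendsto_0)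
    have t3: "(\<lambda>n::nat. d\<^sup>2 * (\<beta> ^ d)\<^sup>2 * exp (2 * d * ln n + (0::real) * real n + (\<alpha> * n - 1) * (ln 2 + c / 2 - c * \<alpha> / 4 * ln n))) \<longlonglongrightarrow> 0"
      using c \<alpha> by (intro exp_neg_linear_ln_tendsto_0) auto
    have t4: "(\<lambda>n::nat. d\<^sup>2 * \<beta> ^ d * 2 * exp (d * ln n + 2 * \<beta> * ln 2 * n +
        (\<alpha> * n - 1) * (e\<^sup>2 * c / 2 - e\<^sup>2 * c * \<alpha> / 2 * ln n))) \<longlonglongrightarrow> 0"
      using c \<alpha> e by (intro exp_neg_linear_ln_tendsto_0) auto
    have t5: "(\<lambda>n::nat. d\<^sup>2 * \<beta> ^ d * exp (0 - 1 * ln n)) \<longlonglongrightarrow> 0"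
      by (rule exp_neg_ln_tendsto_0) simp
    note lim_sum = tendsto_add[OF tendsto_add[OF tendsto_add[OF tendsto_add[OF t1 t2] t3] t4] t5, simplified add_0_right]
    show ?thesis
    proof (rule Lim_transform_eventually[OF lim_sum])
      show "eventually (\<lambda>n. 1 * exp (c / 2 - (c * \<alpha> / 2 - \<eta> * ln 2) * ln n) +
          \<beta> ^ d * d * \<beta> * c\<^sup>2 * ((ln n)\<^sup>2 * exp (4 * d * c - \<delta> * ln n)) +
          d\<^sup>2 * (\<beta> ^ d)\<^sup>2 * exp (2 * d * ln n + (0::real) * real n + (\<alpha> * n - 1) * (ln 2 + c / 2 - c * \<alpha> / 4 * ln n)) +
          d\<^sup>2 * \<beta> ^ d * 2 * exp (d * ln n + 2 * \<beta> * ln 2 * n + (\<alpha> * n - 1) * (e\<^sup>2 * c / 2 - e\<^sup>2 * c * \<alpha> / 2 * ln n)) +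
          d\<^sup>2 * \<beta> ^ d * exp (0 - 1 * ln n) = T n) sequentially"
        using ev
      proof eventually_elim
        case (elim n)
        have n0: "0 < real n" using elim by simp
        define L where "L = ln (real n)"
        \<comment> \<open>Powers of \<open>n\<close> are turned into exponentials of
          \<open>L\<close>, which brings \<open>T n\<close> to the form of the limit lemmas.\<close>
        have nL: "real n = exp L" using n0 by (simp add: L_def)
        have nd: "real n ^ d = exp (d * L)" unfolding nL by (simp add: exp_of_nat_mult)
        \<comment> \<open>The \<open>d + 1\<close> powers of \<open>n\<close> and the two in the
          denominator leave \<open>d - 1\<close>, which cancel against \<open>thk\<close>; the
          exponent \<delta> remains.\<close>
        have e2: "(\<beta> * n) ^ d * (d * (\<beta> * n)) * ((c * L / n)\<^sup>2 * exp (4 * d * c - ((1 - \<theta>) * \<kappa> + 2 * d * \<eta> * ln \<theta>) * L))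
            = \<beta> ^ d * d * \<beta> * c\<^sup>2 * (L\<^sup>2 * exp (4 * d * c - \<delta> * L))"
        proof -
          have "exp (4 * d * c - \<delta> * L) = exp (d * L) * exp (- L) * exp (4 * d * c - ((1 - \<theta>) * \<kappa> + 2 * d * \<eta> * ln \<theta>) * L)"
            unfolding thk exp_add[symmetric] by (simp add: \<delta>_def algebra_simps)
          moreover have "exp (- L) = n / n\<^sup>2" using n0 by (simp add: exp_minus nL[symmetric] power2_eq_square field_simps)
          ultimately show ?thesis
            by (simp add: power_mult_distrib nd power_divide)
        qed
        have e3: "d\<^sup>2 * ((\<beta> * n) ^ d)\<^sup>2 * exp ((\<alpha> * n - 1) * (ln 2 + c / 2 - c * \<alpha> / 4 * L))
           = d\<^sup>2 * (\<beta> ^ d)\<^sup>2 * exp (2 * d * L + (0::real) * real n + (\<alpha> * n - 1) * (ln 2 + c / 2 - c * \<alpha> / 4 * L))"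
        proof -
          have "exp (2 * d * L + (0::real) * real n + (\<alpha> * n - 1) * (ln 2 + c / 2 - c * \<alpha> / 4 * L)) =
            (exp (d * L))\<^sup>2 * exp ((\<alpha> * n - 1) * (ln 2 + c / 2 - c * \<alpha> / 4 * L))"
            by (simp only: exp_add[symmetric] power2_eq_square) (simp add: mult_ac)
          then show ?thesis by (simp add: power_mult_distrib nd)
        qed
        have e4: "d\<^sup>2 * (\<beta> * n) ^ d * (2 * exp (2 * (\<beta> * n) * ln 2 + (\<alpha> * n - 1) * (e\<^sup>2 * c / 2 - e\<^sup>2 * c * \<alpha> / 2 * L)))
           = d\<^sup>2 * \<beta> ^ d * 2 * exp (d * L + 2 * \<beta> * ln 2 * n + (\<alpha> * n - 1) * (e\<^sup>2 * c / 2 - e\<^sup>2 * c * \<alpha> / 2 * L))"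
          by (simp add: power_mult_distrib nd exp_add mult_ac)
        have e5: "d\<^sup>2 * (\<beta> * n) ^ d * exp (- (real d + 1) * L) = d\<^sup>2 * \<beta> ^ d * exp (0 - 1 * L)"
        proof -
          have "exp (0 - 1 * L) = exp (d * L) * exp (- (real d + 1) * L)"
            unfolding exp_add[symmetric] by (simp add: algebra_simps)
          then show ?thesis by (simp add: power_mult_distrib nd)
        qed
        show ?case unfolding T_def L_def[symmetric] by (simp only: e2 e3 e4 e5 mult_1_left)
      qed
    qed
  qed
  then have lim: "(\<lambda>n. 1 - T n) \<longlonglongrightarrow> 1"
    using tendsto_diff[OF tendsto_const, of T 0 sequentially 1] by simp
  show ?thesis
    by (rule tendsto_sandwich[OF lower _ lim tendsto_const]) simp
qed

end
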